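(* Let $f:\{-1,1\}^n\to\{-1,1\}$ be a linear threshold function and $g:\{-1,1\}^n\to[-1,1]$ be any bounded function. If $d_{\mathrm{Chow}}(f,g)\le\epsilon$ then $\mathrm{dist}(f,g)\le 2^{-\Omega(\sqrt[3]{\log(1/\epsilon)})}$.
   Context: A linear threshold function is a function of the form $f(x)=\mathrm{sign}(\sum_{i=1}^n w_ix_i-\theta)$ with real $w_i,\theta$, $\mathrm{sign}(z)=1$ if $z\ge 0$ and $-1$ otherwise. For $h:\{-1,1\}^n\to\mathbb{R}$, the Chow vector is $\vec{\chi}_h=(\hat h(0),\dots,\hat h(n))$ with $\hat h(0)=\mathbb{E}[h(x)]$, $\hat h(i)=\mathbb{E}[h(x)x_i]$ (uniform $x$). $d_{\mathrm{Chow}}(f,g)=\|\vec{\chi}_f-\vec{\chi}_g\|_2$ and $\mathrm{dist}(f,g)=\mathbb{E}[|f(x)-g(x)|]$. *)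

theory Defs
  imports Complex_Main
begin

definition cube :: "nat \<Rightarrow> real list set" where
  "cube n = {x. length x = n \<and> set x \<subseteq> {-1, 1}}"

definition expect :: "nat \<Rightarrow> (real list \<Rightarrow> real) \<Rightarrow> real" where
  "expect n h = (\<Sum>x\<in>cube n. h x) / 2 ^ n"

definition sign :: "real \<Rightarrow> real" where
  "sign z = (if z \<ge> 0 then 1 else -1)"

definition is_LTF :: "nat \<Rightarrow> (real list \<Rightarrow> real) \<Rightarrow> bool" where
  "is_LTF n f \<longleftrightarrow> (\<exists>(w::nat \<Rightarrow> real) (\<theta>::real).
      \<forall>x\<in>cube n. f x = sign ((\<Sum>i<n. w i * x ! i) - \<theta>))"

definition chow :: "nat \<Rightarrow> (real list \<Rightarrow> real) \<Rightarrow> nat \<Rightarrow> real" where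
  "chow n h i = (if i = 0 then expect n h else expect n (\<lambda>x. h x * x ! (i - 1)))"

definition d_chow :: "nat \<Rightarrow> (real list \<Rightarrow> real) \<Rightarrow> (real list \<Rightarrow> real) \<Rightarrow> real" where
  "d_chow n f g = sqrt (\<Sum>i\<le>n. (chow n f i - chow n g i)^2)"

definition dist_fn :: "nat \<Rightarrow> (real list \<Rightarrow> real) \<Rightarrow> (real list \<Rightarrow> real) \<Rightarrow> real" where
  "dist_fn n f g = expect n (\<lambda>x. \<bar>f x - g x\<bar>)"

end

(*
  Write h = f - g. Testing h against the normalised form l defining f gives E[|h| |l|] <= eps, so
  almost all of the mass of h lies on a dense set S of cube points where l is tiny. The key fact is
  that on such an S, up to an exponentially small part, l agrees with a much shorter form l'.

  To find l', let I be a maximal set of coordinates that can be deleted injectively from S; density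
  2^-k gives |I| <= k. By maximality every other coefficient of l is, up to the tiny bound, a
  {-1,0,1}-combination of those in I. By Littlewood-Offord only 4^k coefficients exceed the bound,
  and by a Fejer kernel estimate the others have tiny norm and are discarded with a tail bound. What
  remains is a linear functional on R^I that is tiny on integer vectors of size poly(2^k), and
  Siegel's lemma yields an agreeing functional of norm at most 2^O(k^2) times the tiny bound.

  Consequently, if l was chosen of nearly minimal norm among the forms agreeing with it on the
  previous set, l - l' is a new linear relation on the smaller set. After k + 1 rounds there are k + 1
  independent relations, which leave at most 2^-(k+1) of the cube: a contradiction. Each round loses
  a factor 2^O(k^2), whence eps >= 2^-O(k^3) when the distance is at least 2^-k.
*)
theory Submission
  imports Defs "HOL-Library.Function_Algebras" "HOL-Analysis.Convex"
begin

section \<open>Signed linear forms on the cube\<close>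

text \<open>Testing works because \<open>|g| \<le> 1\<close> gives \<open>h = f - g\<close> the sign
  of \<open>f\<close> wherever it is nonzero, so \<open>h * l = |h| * |l|\<close>, while by
  Cauchy-Schwarz the correlation of \<open>h\<close> with any form of norm at most one is at most
  the Chow distance. In later rounds the tested form agrees with the original one only on the
  current set. Off that set the signs may clash, and only the small mass of \<open>h\<close> there
  and the tail of a normalised form help. This error, divided by the threshold as in Markov's
  inequality, is why a round multiplies the lost mass. The obstacle is that values on a set need not
  determine coefficients: a normalised form can be tiny on the set because its norm sits in
  directions invisible there. Near-minimality of the norm excludes this. A form at most half as long
  cannot agree on the whole set, so agreement on the next set is a genuinely new relation. The
  exponent \<open>k^2\<close> of a round comes from Siegel's lemma for integer vectors with at most
  \<open>k\<close> entries, each of size \<open>2^O(k)\<close>; about \<open>k\<close> rounds make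
  it \<open>k^3\<close>, hence the cube root.\<close>

text \<open>Points of the cube are encoded as subsets of the index set, \<open>A\<close> standing for the sign vector
  \<open>\<lambda>i. chi i A\<close>.\<close>

definition chi :: "'a \<Rightarrow> 'a set \<Rightarrow> real" where
  "chi i A = (if i \<in> A then 1 else -1)"

definition lin :: "'a set \<Rightarrow> ('a \<Rightarrow> real) \<Rightarrow> 'a set \<Rightarrow> real" where
  "lin X a A = (\<Sum>i\<in>X. a i * chi i A)"

lemma abs_chi [simp]: "\<bar>chi i A\<bar> = 1"
  by (simp add: chi_def)

lemma lin_cong: "(\<And>i. i \<in> X \<Longrightarrow> a i = b i) \<Longrightarrow> lin X a A = lin X b A"
  by (simp add: lin_def)

lemma lin_insert_same:
  assumes "finite X" "x \<notin> X"
  shows "lin (insert x X) a (insert x A) = a x + lin X a A"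
proof -
  have "(\<Sum>i\<in>X. a i * chi i (insert x A)) = (\<Sum>i\<in>X. a i * chi i A)"
    by (rule sum.cong) (use assms in \<open>auto simp: chi_def\<close>)
  thus ?thesis using assms by (simp add: lin_def chi_def)
qed

lemma lin_insert_other:
  assumes "finite X" "x \<notin> X" "x \<notin> A"
  shows "lin (insert x X) a A = lin X a A - a x"
  using assms by (simp add: lin_def chi_def)

section \<open>Characteristic function, moment generating function and tails of a signed sum\<close>

lemma sum_Pow_insert:
  fixes F :: "'a set \<Rightarrow> real"
  assumes "finite X" "x \<notin> X"
  shows "(\<Sum>A\<in>Pow (insert x X). F A) = (\<Sum>A\<in>Pow X. F A + F (insert x A))"
proof -
  have "(\<Sum>A\<in>Pow (insert x X). F A) = (\<Sum>A\<in>Pow X. F A) + (\<Sum>A\<in>insert x ` Pow X. F A)"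
    unfolding Pow_insert by (rule sum.union_disjoint) (use assms in auto)
  also have "(\<Sum>A\<in>insert x ` Pow X. F A) = (\<Sum>A\<in>Pow X. F (insert x A))"
    by (rule sum.reindex_cong[of "insert x"]) (use assms in \<open>auto simp: inj_on_def\<close>)
  finally show ?thesis by (simp add: sum.distrib)
qed

text \<open>The real part of the characteristic function of independent signs. The phase
  \<open>c\<close> is left free for the induction: the sign of the new coordinate shifts it by plus
  or minus \<open>a x\<close>, and the two cosines recombine into
  \<open>2 * cos c * cos (a x)\<close>.\<close>

lemma sum_cos_lin:
  assumes "finite X"
  shows "(\<Sum>A\<in>Pow X. cos (c + lin X a A)) = 2 ^ card X * cos c * (\<Prod>i\<in>X. cos (a i))"
  using assms
proof (induction X arbitrary: c)
  case empty
  thus ?case by (simp add: lin_def)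
next
  case (insert x X)
  have "(\<Sum>A\<in>Pow (insert x X). cos (c + lin (insert x X) a A))
      = (\<Sum>A\<in>Pow X. cos ((c - a x) + lin X a A) + cos ((c + a x) + lin X a A))"
    unfolding sum_Pow_insert[OF insert.hyps]
  proof (rule sum.cong)
    fix A assume "A \<in> Pow X"
    hence "x \<notin> A" using insert.hyps by auto
    thus "cos (c + lin (insert x X) a A) + cos (c + lin (insert x X) a (insert x A))
        = cos ((c - a x) + lin X a A) + cos ((c + a x) + lin X a A)"
      using insert.hyps by (simp add: lin_insert_same lin_insert_other algebra_simps)
  qed simp
  also have "\<dots> = 2 ^ card X * (\<Prod>i\<in>X. cos (a i)) * (cos (c - a x) + cos (c + a x))"
    unfolding sum.distrib insert.IH by (simp add: algebra_simps)
  also have "cos (c - a x) + cos (c + a x) = 2 * cos c * cos (a x)"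
    by (simp add: cos_add cos_diff)
  finally show ?case using insert.hyps by simp
qed

lemma sum_exp_lin:
  assumes "finite X"
  shows "(\<Sum>A\<in>Pow X. exp (lin X a A)) = 2 ^ card X * (\<Prod>i\<in>X. cosh (a i))"
  using assms
proof (induction X)
  case empty
  thus ?case by (simp add: lin_def)
next
  case (insert x X)
  have "(\<Sum>A\<in>Pow (insert x X). exp (lin (insert x X) a A))
      = (\<Sum>A\<in>Pow X. exp (lin X a A) * (2 * cosh (a x)))"
    unfolding sum_Pow_insert[OF insert.hyps]
  proof (rule sum.cong)
    fix A assume "A \<in> Pow X"
    hence "x \<notin> A" using insert.hyps by auto
    thus "exp (lin (insert x X) a A) + exp (lin (insert x X) a (insert x A))
        = exp (lin X a A) * (2 * cosh (a x))"
      using insert.hyps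
      by (simp add: lin_insert_same lin_insert_other exp_add exp_diff exp_minus cosh_def field_simps)
  qed simp
  also have "\<dots> = 2 ^ card X * (\<Prod>i\<in>X. cosh (a i)) * (2 * cosh (a x))"
    by (simp only: insert.IH flip: sum_distrib_right)
  finally show ?case using insert.hyps by simp
qed

text \<open>This compares Taylor coefficients: those of \<open>exp (x\<^sup>2 / 2)\<close> dominate
  those of \<open>cosh x\<close>.\<close>

lemma two_pow_fact_le: "2 ^ n * fact n \<le> (fact (2 * n) :: real)"
proof (induction n)
  case (Suc n)
  have "2 ^ Suc n * fact (Suc n) = (2 * (real n + 1)) * (2 ^ n * fact n :: real)"
    by (simp add: algebra_simps)
  also have "\<dots> \<le> ((2 * real n + 2) * (2 * real n + 1)) * fact (2 * n)"
    by (rule mult_mono) (use Suc in \<open>auto simp: algebra_simps\<close>)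
  also have "\<dots> = fact (2 * Suc n)" by (simp add: algebra_simps)
  finally show ?case .
qed simp

lemma cosh_le_exp_sq: "cosh x \<le> exp (x\<^sup>2 / 2)" for x :: real
proof (rule sums_le[OF _ cosh_converges])
  \<comment> \<open>The exponential series, padded with zeros at odd indices so that it can be
    compared term by term with the series of \<open>cosh\<close>.\<close>
  let ?g = "\<lambda>n. if even n then (x\<^sup>2 / 2) ^ (n div 2) /\<^sub>R fact (n div 2) else 0"
  have "(\<lambda>n. (x\<^sup>2 / 2) ^ n /\<^sub>R fact n) sums exp (x\<^sup>2 / 2)"
    by (rule exp_converges)
  hence "(\<lambda>n. ?g (2 * n)) sums exp (x\<^sup>2 / 2)"
    by simp
  also have "(\<lambda>n. ?g (2 * n)) sums exp (x\<^sup>2 / 2) \<longleftrightarrow> ?g sums exp (x\<^sup>2 / 2)"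
    by (rule sums_mono_reindex) (auto simp: strict_mono_def elim!: evenE)
  finally show "?g sums exp (x\<^sup>2 / 2)" .
  fix n
  show "(if even n then x ^ n /\<^sub>R fact n else 0) \<le> ?g n"
  proof (cases "even n")
    case True
    then obtain m where n: "n = 2 * m" by (auto elim: evenE)
    have "x ^ (2 * m) / fact (2 * m) \<le> x ^ (2 * m) / (2 ^ m * fact m)"
      by (rule divide_left_mono[OF two_pow_fact_le]) auto
    thus ?thesis by (simp add: n power_divide field_simps flip: power_mult)
  qed simp
qed

text \<open>The subgaussian estimate, applied to \<open>2 * a\<close> and \<open>-2 * a\<close>.
  Each sign contributes a mean of at most \<open>exp 2 \<le> 9\<close>, hence 18. The rate 2 leaves
  one factor \<open>exp |y|\<close> to pay for \<open>exp (-T)\<close> and one to pay for a weight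
  \<open>|y|\<close> in the tail bound.\<close>

lemma sum_exp_abs_lin_le:
  assumes "finite X" "(\<Sum>i\<in>X. (a i)\<^sup>2) \<le> 1"
  shows "(\<Sum>A\<in>Pow X. exp (2 * \<bar>lin X a A\<bar>)) \<le> 18 * 2 ^ card X"
proof -
  have *: "(\<Sum>A\<in>Pow X. exp (lin X b A)) \<le> 2 ^ card X * exp 2" if b: "\<And>i. (b i)\<^sup>2 = 4 * (a i)\<^sup>2" for b
  proof -
    have "(\<Prod>i\<in>X. cosh (b i)) \<le> (\<Prod>i\<in>X. exp ((b i)\<^sup>2 / 2))"
      by (rule prod_mono) (auto simp: cosh_le_exp_sq)
    also have "\<dots> = exp (2 * (\<Sum>i\<in>X. (a i)\<^sup>2))"
      using assms by (simp add: exp_sum b sum_distrib_left)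
    also have "\<dots> \<le> exp 2" using assms by simp
    finally show ?thesis using assms by (simp add: sum_exp_lin)
  qed
  have e: "exp (2::real) \<le> 9"
    using power_mono[OF exp_le, of 2] by (simp flip: exp_double)
  have s: "lin X (\<lambda>i. c * a i) A = c * lin X a A" for c A
    by (simp add: lin_def sum_distrib_left mult.assoc)
  have abs: "exp (2 * \<bar>y\<bar>) \<le> exp (2 * y) + exp (-2 * y)" for y :: real
    by (cases "y < 0") (simp_all add: abs_if)
  have "(\<Sum>A\<in>Pow X. exp (2 * \<bar>lin X a A\<bar>))
      \<le> (\<Sum>A\<in>Pow X. exp (lin X (\<lambda>i. 2 * a i) A) + exp (lin X (\<lambda>i. -2 * a i) A))"
    unfolding s by (rule sum_mono) (rule abs)
  also have "\<dots> \<le> 2 ^ card X * exp 2 + 2 ^ card X * exp 2"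
    unfolding sum.distrib by (intro add_mono *) (auto simp: power2_eq_square)
  also have "\<dots> = 2 ^ card X * (2 * exp 2)" by simp
  also have "\<dots> \<le> 2 ^ card X * 18" by (rule mult_left_mono) (use e in auto)
  finally show ?thesis by (simp add: mult.commute)
qed

text \<open>For \<open>|y| > T\<close> one has
  \<open>|y| \<le> exp |y| \<le> exp (-T) * exp (2 * |y|)\<close>. The weighted form is needed
  because the tail enters the correlation multiplied by the size of the linear form.\<close>

lemma sum_abs_lin_tail_le:
  assumes "finite X" "(\<Sum>i\<in>X. (a i)\<^sup>2) \<le> 1"
  shows "(\<Sum>A | A \<in> Pow X \<and> T < \<bar>lin X a A\<bar>. \<bar>lin X a A\<bar>) \<le> 18 * exp (-T) * 2 ^ card X"
proof -
  have "(\<Sum>A | A \<in> Pow X \<and> T < \<bar>lin X a A\<bar>. \<bar>lin X a A\<bar>)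
     \<le> (\<Sum>A | A \<in> Pow X \<and> T < \<bar>lin X a A\<bar>. exp (-T) * exp (2 * \<bar>lin X a A\<bar>))"
  proof (rule sum_mono)
    fix A assume "A \<in> {A \<in> Pow X. T < \<bar>lin X a A\<bar>}"
    hence "exp \<bar>lin X a A\<bar> \<le> exp (-T) * exp (2 * \<bar>lin X a A\<bar>)" by (simp flip: exp_add)
    moreover have "\<bar>lin X a A\<bar> \<le> exp \<bar>lin X a A\<bar>"
      using exp_ge_add_one_self[of "\<bar>lin X a A\<bar>"] by linarith
    ultimately show "\<bar>lin X a A\<bar> \<le> exp (-T) * exp (2 * \<bar>lin X a A\<bar>)" by linarith
  qed
  also have "\<dots> \<le> (\<Sum>A\<in>Pow X. exp (-T) * exp (2 * \<bar>lin X a A\<bar>))"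
    by (rule sum_mono2) (use assms in auto)
  also have "\<dots> \<le> exp (-T) * (18 * 2 ^ card X)"
    unfolding sum_distrib_left[symmetric] by (rule mult_left_mono[OF sum_exp_abs_lin_le[OF assms]]) auto
  finally show ?thesis by (simp add: mult_ac)
qed

lemma card_lin_tail_le:
  assumes "finite X" "(\<Sum>i\<in>X. (a i)\<^sup>2) \<le> 1" "T \<ge> 1"
  shows "card {A \<in> Pow X. T < \<bar>lin X a A\<bar>} \<le> 18 * exp (-T) * 2 ^ card X"
proof -
  have "card {A \<in> Pow X. T < \<bar>lin X a A\<bar>} = (\<Sum>A | A \<in> Pow X \<and> T < \<bar>lin X a A\<bar>. 1::real)"
    by simp
  also have "\<dots> \<le> (\<Sum>A | A \<in> Pow X \<and> T < \<bar>lin X a A\<bar>. \<bar>lin X a A\<bar>)"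
    by (rule sum_mono) (use assms in auto)
  also have "\<dots> \<le> 18 * exp (-T) * 2 ^ card X" by (rule sum_abs_lin_tail_le[OF assms(1,2)])
  finally show ?thesis .
qed

section \<open>Few large coefficients\<close>

text \<open>Averaging over a deleted point \<open>i\<close>: the members of \<open>F\<close>
  avoiding \<open>i\<close> form an antichain in \<open>X - {i}\<close>, so the induction hypothesis
  applies to them. In the sum over \<open>i\<close> each \<open>A\<close> is counted
  \<open>card (X - A)\<close> times, which the absorption identity for binomials converts into the
  weight for \<open>X\<close>. The set \<open>X\<close> itself avoids no point and is treated
  apart.\<close>

lemma lym_inequality:
  assumes "finite X" "F \<subseteq> Pow X" "\<And>A B. A \<in> F \<Longrightarrow> B \<in> F \<Longrightarrow> A \<subseteq> B \<Longrightarrow> A = B"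
  shows "(\<Sum>A\<in>F. 1 / real (card X choose card A)) \<le> 1"
  using assms
proof (induction "card X" arbitrary: X F)
  case 0
  hence "F \<subseteq> {{}}" by auto
  hence "F = {} \<or> F = {{}}" by auto
  thus ?case using 0 by auto
next
  case (Suc m)
  have finF: "finite F" using Suc.prems by (meson finite_Pow_iff finite_subset)
  show ?case
  proof (cases "X \<in> F")
    case True
    hence "F = {X}" using Suc.prems by blast
    thus ?thesis by simp
  next
    case False
    have lt: "card A < Suc m" and fin: "finite A" if "A \<in> F" for A
      using that False Suc.prems Suc.hyps(2)
      by (metis Pow_iff psubset_card_mono psubsetI subsetD, metis Pow_iff finite_subset subsetD)
    have id: "real (Suc m) * (1 / real (Suc m choose card A))
        = (\<Sum>i\<in>X - A. 1 / real (m choose card A))" if A: "A \<in> F" for A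
    proof -
      have "card (X - A) = Suc m - card A"
        using A Suc.prems Suc.hyps(2) fin[OF A] by (subst card_Diff_subset) auto
      moreover have "(Suc m - card A) * (Suc m choose card A) = Suc m * (m choose card A)"
        using binomial_absorb_comp[of "Suc m" "card A"] by simp
      hence "real (Suc m - card A) * real (Suc m choose card A) = real (Suc m) * real (m choose card A)"
        by (metis of_nat_mult)
      moreover have "m choose card A > 0" "Suc m choose card A > 0"
        using lt[OF A] by auto
      ultimately show ?thesis by (simp add: field_simps del: binomial_Suc_Suc)
    qed
    have "real (Suc m) * (\<Sum>A\<in>F. 1 / real (card X choose card A))
        = (\<Sum>A\<in>F. \<Sum>i\<in>X - A. 1 / real (m choose card A))"
      unfolding sum_distrib_left Suc.hyps(2)[symmetric] by (rule sum.cong[OF refl id])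
    also have "\<dots> = (\<Sum>A\<in>F. \<Sum>i | i \<in> X \<and> i \<notin> A. 1 / real (m choose card A))"
      by (simp add: set_diff_eq)
    also have "\<dots> = (\<Sum>i\<in>X. \<Sum>A | A \<in> F \<and> i \<notin> A. 1 / real (m choose card A))"
      by (rule sum.swap_restrict) (use finF Suc.prems in auto)
    also have "\<dots> \<le> (\<Sum>i\<in>X. 1)"
    proof (rule sum_mono)
      fix i assume i: "i \<in> X"
      have c: "m = card (X - {i})" using i Suc.hyps(2) Suc.prems by simp
      have "(\<Sum>A | A \<in> F \<and> i \<notin> A. 1 / real (card (X - {i}) choose card A)) \<le> 1"
        by (rule Suc.hyps(1)[OF c]) (use Suc.prems in auto)
      thus "(\<Sum>A | A \<in> F \<and> i \<notin> A. 1 / real (m choose card A)) \<le> 1" using c by simp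
    qed
    also have "\<dots> = real (Suc m)" using Suc.hyps(2) by simp
    finally show ?thesis by (simp add: mult_le_cancel_left1 del: of_nat_Suc)
  qed
qed

text \<open>The bound \<open>4^p / sqrt (2p+1)\<close>, squared to stay in the natural numbers. The
  factor \<open>2 * p + 1\<close> makes the induction close, since
  \<open>(2p+3)(2p+1) \<le> (2p+2)^2\<close>.\<close>

lemma central_binomial_sq_le: "(2 * p + 1) * (2 * p choose p)\<^sup>2 \<le> 16 ^ p"
proof (induction p)
  case (Suc p)
  have a: "Suc p * Suc p * (2 * Suc p choose Suc p) = (2 * p + 2) * (2 * p + 1) * (2 * p choose p)"
  proof -
    have "Suc p * (2 * Suc p choose Suc p) = (2 * p + 2) * (Suc (2 * p) choose p)"
      using binomial_absorption[of p "2 * p + 2"] by simp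
    moreover have "Suc p * (Suc (2 * p) choose p) = (2 * p + 1) * (2 * p choose p)"
      using binomial_absorb_comp[of "Suc (2 * p)" p] by simp
    ultimately show ?thesis by (metis mult.assoc mult.left_commute)
  qed
  hence b: "Suc p * (2 * Suc p choose Suc p) = 2 * (2 * p + 1) * (2 * p choose p)"
  proof -
    have "Suc p * (Suc p * (2 * Suc p choose Suc p)) = Suc p * (2 * (2 * p + 1) * (2 * p choose p))"
      using a by (simp add: algebra_simps)
    thus ?thesis by (simp only: mult_cancel1 nat.simps simp_thms)
  qed
  have sq: "(Suc p)\<^sup>2 * ((2 * Suc p + 1) * c\<^sup>2) = (2 * p + 3) * (Suc p * c)\<^sup>2" for c
    by (simp add: power2_eq_square algebra_simps)
  have "(Suc p)\<^sup>2 * ((2 * Suc p + 1) * (2 * Suc p choose Suc p)\<^sup>2)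
      = (2 * p + 3) * (Suc p * (2 * Suc p choose Suc p))\<^sup>2"
    using sq by blast
  also have "\<dots> = (4 * (2 * p + 3) * (2 * p + 1)) * ((2 * p + 1) * (2 * p choose p)\<^sup>2)"
    unfolding b by (simp add: power2_eq_square algebra_simps)
  also have "\<dots> \<le> (16 * (Suc p)\<^sup>2) * 16 ^ p"
    by (rule mult_mono[OF _ Suc]) (auto simp: power2_eq_square algebra_simps)
  finally have "(Suc p)\<^sup>2 * ((2 * Suc p + 1) * (2 * Suc p choose Suc p)\<^sup>2) \<le> (Suc p)\<^sup>2 * 16 ^ Suc p"
    by (simp add: mult_ac)
  thus ?case by (simp del: binomial_Suc_Suc add: mult_le_cancel1)
qed simp

lemma binomial_sq_le: "m * (m choose r)\<^sup>2 \<le> 4 ^ m"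
proof (cases "even m")
  case True
  then obtain p where p: "m = 2 * p" by (auto elim: evenE)
  have "m * (m choose r)\<^sup>2 \<le> (2 * p + 1) * (2 * p choose p)\<^sup>2"
    by (rule mult_mono) (use p binomial_maximum'[of p r] in \<open>auto intro: power_mono\<close>)
  also have "\<dots> \<le> 4 ^ m" using central_binomial_sq_le[of p] p by (simp add: power_mult)
  finally show ?thesis .
next
  case False
  then obtain p where p: "m = 2 * p + 1" by (auto elim: oddE)
  have "(m choose r) \<le> (m choose p)" using binomial_maximum[of m r] p by simp
  \<comment> \<open>The middle coefficient of an odd row is half the central coefficient of the next
    row.\<close>
  moreover have "2 * (m choose p) = (2 * Suc p choose Suc p)"
    using p binomial_symmetric[of p m] by simp
  ultimately have "2 * (m choose r) \<le> (2 * Suc p choose Suc p)" by simp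
  hence "(2 * Suc p + 1) * (2 * (m choose r))\<^sup>2 \<le> (2 * Suc p + 1) * (2 * Suc p choose Suc p)\<^sup>2"
    by (intro mult_left_mono power_mono) auto
  also have "\<dots> \<le> 16 ^ Suc p" by (rule central_binomial_sq_le)
  also have "\<dots> = 4 * 4 ^ m" using p by (simp add: power_mult power_add)
  finally have "4 * ((2 * Suc p + 1) * (m choose r)\<^sup>2) \<le> 4 * 4 ^ m" by (simp add: power_mult_distrib)
  hence "(2 * Suc p + 1) * (m choose r)\<^sup>2 \<le> 4 ^ m" by simp
  moreover have "m * (m choose r)\<^sup>2 \<le> (2 * Suc p + 1) * (m choose r)\<^sup>2"
    by (rule mult_right_mono) (use p in auto)
  ultimately show ?thesis by linarith
qed

text \<open>Sperner's theorem: every term of the LYM sum is at least the reciprocal of the middle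
  binomial coefficient.\<close>

lemma card_antichain_le:
  assumes "finite X" "F \<subseteq> Pow X" "\<And>A B. A \<in> F \<Longrightarrow> B \<in> F \<Longrightarrow> A \<subseteq> B \<Longrightarrow> A = B"
  shows "card F \<le> (card X choose (card X div 2))"
proof -
  let ?b = "card X choose (card X div 2)"
  have "real (card F) / ?b = (\<Sum>A\<in>F. 1 / real ?b)" by simp
  also have "\<dots> \<le> (\<Sum>A\<in>F. 1 / real (card X choose card A))"
  proof (rule sum_mono)
    fix A assume "A \<in> F"
    hence "card A \<le> card X" using assms by (auto intro: card_mono)
    hence "0 < card X choose card A" by auto
    thus "1 / real ?b \<le> 1 / real (card X choose card A)"
      using binomial_maximum[of "card X" "card A"] by (intro divide_left_mono) auto
  qed
  also have "\<dots> \<le> 1" by (rule lym_inequality[OF assms])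
  finally show ?thesis by (simp add: divide_le_eq)
qed

text \<open>Erdos' argument: after the signs of the coefficients are absorbed by a symmetric
  difference, each fibre of \<open>S\<close> over the remaining coordinates is an antichain.\<close>

lemma card_le_of_large_coeffs:
  assumes X: "finite X" and S: "S \<subseteq> Pow X" and J: "J \<subseteq> X"
    and small: "\<And>A. A \<in> S \<Longrightarrow> \<bar>lin X l A\<bar> \<le> \<beta>"
    and large: "\<And>j. j \<in> J \<Longrightarrow> \<beta> < \<bar>l j\<bar>"
  shows "card S \<le> 2 ^ (card X - card J) * (card J choose (card J div 2))"
proof -
  have finJ: "finite J" using J X by (rule finite_subset)
  define N where "N = {j\<in>J. l j < 0}"
  define G where "G B = (\<lambda>A. sym_diff (A \<inter> J) N) ` {A\<in>S. A - J = B}" for B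
  have finS: "finite S" using S X by (meson finite_Pow_iff finite_subset)
  have inj: "inj_on (\<lambda>A. sym_diff (A \<inter> J) N) {A\<in>S. A - J = B}" for B
  proof (rule inj_onI)
    fix A A' assume A: "A \<in> {A\<in>S. A - J = B}" "A' \<in> {A\<in>S. A - J = B}"
      and eq: "sym_diff (A \<inter> J) N = sym_diff (A' \<inter> J) N"
    have "A \<inter> J = A' \<inter> J" using eq by blast
    moreover have "A - J = A' - J" using A by simp
    ultimately show "A = A'" by blast
  qed
  have anti: "card (G B) \<le> (card J choose (card J div 2))" for B
  proof (rule card_antichain_le[OF finJ])
    show "G B \<subseteq> Pow J" by (auto simp: G_def N_def)
    fix U V assume U: "U \<in> G B" and V: "V \<in> G B" and UV: "U \<subseteq> V"
    show "U = V"
    proof (rule ccontr)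
      assume ne: "U \<noteq> V"
      obtain A where A: "A \<in> S" "A - J = B" "U = sym_diff (A \<inter> J) N" using U by (auto simp: G_def)
      obtain A' where A': "A' \<in> S" "A' - J = B" "V = sym_diff (A' \<inter> J) N" using V by (auto simp: G_def)
      have off: "i \<in> A \<longleftrightarrow> i \<in> A'" if "i \<notin> J" for i using A(2) A'(2) that by blast
      have chiU: "chi i A = sgn (l i) * chi i U" if "i \<in> J" for i
        using that large[OF that] A(3) small[OF A(1)] by (auto simp: chi_def N_def sgn_if)
      have chiV: "chi i A' = sgn (l i) * chi i V" if "i \<in> J" for i
        using that large[OF that] A'(3) small[OF A(1)] by (auto simp: chi_def N_def sgn_if)
      \<comment> \<open>Within a fibre, passing from \<open>U\<close> to a larger \<open>V\<close>
        raises the form by \<open>2 * |l i|\<close> for each added \<open>i\<close>, hence by more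
        than \<open>2 * \<beta>\<close>. Two values of absolute value at most \<open>\<beta>\<close>
        cannot differ so much.\<close>
      have "lin X l A' - lin X l A = (\<Sum>i\<in>X. l i * (chi i A' - chi i A))"
        by (simp add: lin_def sum_subtractf algebra_simps)
      also have "\<dots> = (\<Sum>i\<in>J. l i * (chi i A' - chi i A))"
        by (rule sum.mono_neutral_right) (use X J off in \<open>auto simp: chi_def\<close>)
      also have "\<dots> = (\<Sum>i\<in>J. \<bar>l i\<bar> * (chi i V - chi i U))"
        by (rule sum.cong) (auto simp: chiU chiV algebra_simps abs_sgn)
      also have "\<dots> = (\<Sum>i\<in>V - U. \<bar>l i\<bar> * (chi i V - chi i U))"
        by (rule sum.mono_neutral_right)
          (use finJ UV A'(3) in \<open>auto simp: chi_def N_def\<close>)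
      also have "\<dots> = (\<Sum>i\<in>V - U. 2 * \<bar>l i\<bar>)"
        by (rule sum.cong) (auto simp: chi_def)
      finally have eq: "lin X l A' - lin X l A = (\<Sum>i\<in>V - U. 2 * \<bar>l i\<bar>)" .
      obtain v where v: "v \<in> V - U" using ne UV by blast
      have VJ: "V - U \<subseteq> J" using A'(3) by (auto simp: N_def)
      have "2 * \<bar>l v\<bar> \<le> (\<Sum>i\<in>V - U. 2 * \<bar>l i\<bar>)"
        by (rule member_le_sum[OF v]) (use finite_subset[OF VJ finJ] in auto)
      moreover have "\<beta> < \<bar>l v\<bar>" using v VJ large by blast
      ultimately show False using eq small[OF A(1)] small[OF A'(1)] by linarith
    qed
  qed
  have "card S = card (\<Union>B\<in>Pow (X - J). {A\<in>S. A - J = B})"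
    by (rule arg_cong[of _ _ card]) (use S in auto)
  also have "\<dots> \<le> (\<Sum>B\<in>Pow (X - J). card {A\<in>S. A - J = B})"
    by (rule card_UN_le) (use X in auto)
  also have "\<dots> \<le> (\<Sum>B\<in>Pow (X - J). card J choose (card J div 2))"
    by (rule sum_mono) (use anti card_image[OF inj] in \<open>simp add: G_def\<close>)
  also have "\<dots> = 2 ^ (card X - card J) * (card J choose (card J div 2))"
    using X J finJ by (simp add: card_Pow card_Diff_subset)
  finally show ?thesis .
qed

text \<open>With \<open>m\<close> large coefficients, the density bound gives
  \<open>2^m \<le> 2^k * (m choose (m div 2))\<close>. Squaring and multiplying by \<open>m\<close>
  brings in \<open>binomial_sq_le\<close>, and \<open>4^m\<close> cancels.\<close>

lemma card_large_coeffs_le: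
  assumes X: "finite X" and S: "S \<subseteq> Pow X" and dens: "2 ^ card X \<le> 2 ^ k * card S"
    and small: "\<And>A. A \<in> S \<Longrightarrow> \<bar>lin X l A\<bar> \<le> \<beta>"
  shows "card {j\<in>X. \<beta> < \<bar>l j\<bar>} \<le> 4 ^ k"
proof -
  define m where "m = card {j\<in>X. \<beta> < \<bar>l j\<bar>}"
  define b where "b = (m choose (m div 2))"
  have m: "m \<le> card X" unfolding m_def by (rule card_mono) (use X in auto)
  have "card S \<le> 2 ^ (card X - m) * b"
    unfolding m_def b_def by (rule card_le_of_large_coeffs[OF X S _ small]) auto
  hence "2 ^ card X \<le> 2 ^ k * (2 ^ (card X - m) * b)"
    using dens by (meson le_trans mult_le_mono2)
  moreover have "2 ^ card X = 2 ^ m * (2::nat) ^ (card X - m)" using m by (simp flip: power_add)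
  ultimately have "2 ^ (card X - m) * 2 ^ m \<le> 2 ^ (card X - m) * (2 ^ k * b)" by (simp add: mult_ac)
  hence "2 ^ m \<le> 2 ^ k * b" by simp
  hence "(2 ^ m)\<^sup>2 \<le> (2 ^ k * b)\<^sup>2" by (rule power_mono) simp
  hence "4 ^ m \<le> 4 ^ k * b\<^sup>2"
    by (simp add: power_mult_distrib power_mult[symmetric] mult.commute[of _ 2] power_mult[of 2 2])
  hence "m * 4 ^ m \<le> 4 ^ k * (m * b\<^sup>2)" by (metis mult.left_commute mult_le_mono2)
  also have "\<dots> \<le> 4 ^ k * 4 ^ m" unfolding b_def by (rule mult_le_mono2[OF binomial_sq_le])
  finally show ?thesis by (simp add: m_def)
qed

section \<open>Small norm of the remaining coefficients\<close>

lemma abs_cos_le_exp: 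
  fixes x :: real
  assumes "\<bar>x\<bar> \<le> 1"
  shows "\<bar>cos x\<bar> \<le> exp (- (x\<^sup>2 / 4))"
proof -
  have "cos x \<le> 1 - x\<^sup>2 / 4"
  proof -
    obtain t where t: "cos x = (\<Sum>m<4. cos_coeff m * x ^ m) + (cos (t + 1/2 * real 4 * pi) / fact 4) * x ^ 4"
      using Maclaurin_cos_expansion[of x 4] by blast
    have "(cos (t + 1/2 * real 4 * pi) / fact 4) * x ^ 4 \<le> 1 / 24 * x ^ 4"
      by (rule mult_right_mono) (auto simp: fact_numeral)
    moreover have "(\<Sum>m<4. cos_coeff m * x ^ m) = 1 - x\<^sup>2 / 2"
    proof -
      have "{..<4} = {0, 1, 2, 3::nat}" by auto
      thus ?thesis by (simp add: cos_coeff_def)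
    qed
    moreover have "x ^ 4 \<le> x\<^sup>2"
      using power_decreasing[of 2 4 "\<bar>x\<bar>"] assms by (simp add: power_even_abs)
    ultimately show ?thesis using t zero_le_power2[of x] by linarith
  qed
  also have "\<dots> \<le> exp (- (x\<^sup>2 / 4))" using exp_ge_add_one_self[of "- (x\<^sup>2 / 4)"] by simp
  finally have "cos x \<le> exp (- (x\<^sup>2 / 4))" .
  moreover have "0 \<le> cos x" by (rule cos_ge_zero) (use assms pi_ge_two in auto)
  ultimately show ?thesis by simp
qed

lemma four_power: "(4::'a::comm_semiring_1) ^ k = (2 ^ k)\<^sup>2"
proof -
  have "(4::'a) = 2 * 2" by simp
  thus ?thesis by (simp only: power2_eq_square power_mult_distrib)
qed

text \<open>The double sum is the squared modulus of a geometric sum of unit phases, that is, an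
  unnormalised Fejer kernel with peak \<open>M^2\<close>. Under the hypothesis all phases have
  absolute value at most 1, where the cosine is at least one half.\<close>

lemma fejer_ge:
  fixes y s :: real
  assumes "real M * \<bar>s * y\<bar> \<le> 1"
  shows "real M ^ 2 / 2 \<le> (\<Sum>t<M. \<Sum>t'<M. cos ((real t - real t') * s * y))"
proof -
  have "real M ^ 2 / 2 = (\<Sum>t<M. \<Sum>t'<M. 1 / 2)" by (simp add: power2_eq_square)
  also have "\<dots> \<le> (\<Sum>t<M. \<Sum>t'<M. cos ((real t - real t') * s * y))"
  proof (intro sum_mono)
    fix t t' assume "t \<in> {..<M}" "t' \<in> {..<M}"
    hence "\<bar>real t - real t'\<bar> * \<bar>s * y\<bar> \<le> real M * \<bar>s * y\<bar>" by (intro mult_right_mono) auto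
    hence le: "\<bar>(real t - real t') * s * y\<bar> \<le> 1" using assms by (simp add: abs_mult mult.assoc)
    have "1 / 2 \<le> cos z" if "\<bar>z\<bar> \<le> 1" for z :: real
    proof -
      have "\<bar>sin (z / 2)\<bar> \<le> 1 / 2" using abs_sin_x_le_abs_x[of "z / 2"] that by simp
      hence "(sin (z / 2))\<^sup>2 \<le> (1 / 2)\<^sup>2" using abs_le_square_iff[of "sin (z / 2)" "1 / 2"] by simp
      thus ?thesis using cos_double_sin[of "z / 2"] by (simp add: power2_eq_square)
    qed
    thus "1 / 2 \<le> cos ((real t - real t') * s * y)" using le by blast
  qed
  finally show ?thesis .
qed

text \<open>The Fejer kernel with \<open>M = 8 * 2 ^ k\<close> terms and step \<open>1 / (M * \<beta>)\<close> is at least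
  one half of its peak on \<open>S\<close>, while its mean over the cube is a sum of cosine products.\<close>

lemma small_coeffs_norm_le:
  assumes X: "finite X" and S: "S \<subseteq> Pow X" and dens: "2 ^ card X \<le> 2 ^ k * card S"
    and b: "0 < \<beta>" and small: "\<And>A. A \<in> S \<Longrightarrow> \<bar>lin X l A\<bar> \<le> \<beta>"
    and R: "R \<subseteq> X" "\<And>j. j \<in> R \<Longrightarrow> \<bar>l j\<bar> \<le> \<beta>"
  shows "(\<Sum>j\<in>R. (l j)\<^sup>2) \<le> 256 * (real k + 2) * 4 ^ k * \<beta>\<^sup>2"
proof (rule ccontr)
  define M :: nat where "M = 8 * 2 ^ k"
  define s where "s = 1 / (real M * \<beta>)"
  define N :: real where "N = 2 ^ card X"
  assume "\<not> ?thesis"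
  hence big: "(\<Sum>j\<in>R. (l j)\<^sup>2) > 256 * (real k + 2) * 4 ^ k * \<beta>\<^sup>2" by simp
  have M: "M > 0" by (simp add: M_def)
  have s: "s > 0" using b M by (simp add: s_def)
  have Ms: "real M * s * \<beta> = 1" using b M by (simp add: s_def)
  have N: "N > 0" by (simp add: N_def)
  have finR: "finite R" using R(1) X by (rule finite_subset)
  \<comment> \<open>These are the off-diagonal terms. On \<open>R\<close> all phases stay within 1,
    so each cosine has a Gaussian bound, and the assumed excess of the norm makes the product at
    most \<open>exp (- (k + 2))\<close>. Factors outside \<open>R\<close> are bounded by 1.\<close>
  have prod_le: "(\<Prod>j\<in>X. \<bar>cos (d * s * l j)\<bar>) \<le> 1 / (4 * 2 ^ k)" if d: "1 \<le> \<bar>d\<bar>" "\<bar>d\<bar> \<le> real M" for d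
  proof -
    have "(\<Prod>j\<in>X. \<bar>cos (d * s * l j)\<bar>) = (\<Prod>j\<in>R. \<bar>cos (d * s * l j)\<bar>) * (\<Prod>j\<in>X - R. \<bar>cos (d * s * l j)\<bar>)"
      using prod.subset_diff[OF R(1) X] by (simp add: mult.commute)
    also have "\<dots> \<le> (\<Prod>j\<in>R. \<bar>cos (d * s * l j)\<bar>) * 1"
      by (intro mult_left_mono prod_le_1 prod_nonneg) auto
    also have "\<dots> \<le> (\<Prod>j\<in>R. exp (- ((s * l j)\<^sup>2 / 4)))"
      unfolding mult_1_right
    proof (rule prod_mono, intro conjI)
      fix j assume j: "j \<in> R"
      have "\<bar>d\<bar> * s * \<bar>l j\<bar> \<le> real M * s * \<beta>"
        by (intro mult_mono) (use d s R(2)[OF j] in auto)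
      hence "\<bar>d * s * l j\<bar> \<le> 1" using Ms s by (simp add: abs_mult)
      hence "\<bar>cos (d * s * l j)\<bar> \<le> exp (- ((d * s * l j)\<^sup>2 / 4))" by (rule abs_cos_le_exp)
      also have "\<dots> \<le> exp (- ((s * l j)\<^sup>2 / 4))"
      proof -
        have "1 * (s * l j)\<^sup>2 \<le> d\<^sup>2 * (s * l j)\<^sup>2"
          by (rule mult_right_mono) (use d power_mono[OF d(1), of 2] in auto)
        thus ?thesis by (simp add: power_mult_distrib mult_ac)
      qed
      finally show "\<bar>cos (d * s * l j)\<bar> \<le> exp (- ((s * l j)\<^sup>2 / 4))" .
    qed auto
    also have "\<dots> = exp (- (s\<^sup>2 * (\<Sum>j\<in>R. (l j)\<^sup>2) / 4))"
      using finR by (simp add: sum_negf sum_distrib_left sum_divide_distrib power_mult_distrib flip: exp_sum)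
    also have "\<dots> \<le> exp (- (real k + 2))"
    proof -
      have "(real k + 2) * 4 = s\<^sup>2 * (256 * (real k + 2) * 4 ^ k * \<beta>\<^sup>2)"
      proof -
        have "s\<^sup>2 * (real M)\<^sup>2 * \<beta>\<^sup>2 = 1" using arg_cong[OF Ms, of "\<lambda>x. x\<^sup>2"] by (simp add: power_mult_distrib mult_ac)
        moreover have "(real M)\<^sup>2 = 64 * 4 ^ k" by (simp add: M_def power_mult_distrib four_power)
        ultimately have "s\<^sup>2 * (64 * 4 ^ k) * \<beta>\<^sup>2 = 1" by simp
        moreover have "s\<^sup>2 * (256 * (real k + 2) * 4 ^ k * \<beta>\<^sup>2) = 4 * (real k + 2) * (s\<^sup>2 * (64 * 4 ^ k) * \<beta>\<^sup>2)"
          by simp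
        ultimately show ?thesis by simp
      qed
      also have "\<dots> \<le> s\<^sup>2 * (\<Sum>j\<in>R. (l j)\<^sup>2)" by (rule mult_left_mono) (use big in auto)
      finally show ?thesis by simp
    qed
    also have "\<dots> = exp (real (k + 2) * - 1)" by simp
    also have "\<dots> = exp (- 1) ^ (k + 2)" by (rule exp_of_nat_mult)
    also have "\<dots> \<le> (1 / 2) ^ (k + 2)"
    proof (rule power_mono)
      have "2 \<le> exp (1::real)" using exp_ge_add_one_self[of "1::real"] by simp
      thus "exp (- 1) \<le> (1 / 2 :: real)" using le_imp_inverse_le[of 2 "exp (1::real)"] by (simp add: exp_minus)
    qed auto
    finally show ?thesis by (simp add: power_one_over field_simps)
  qed
  have mean: "(\<Sum>A\<in>Pow X. cos (d * s * lin X l A)) = N * (\<Prod>j\<in>X. cos (d * s * l j))" for d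
  proof -
    have "lin X (\<lambda>j. d * s * l j) A = d * s * lin X l A" for A
      by (simp add: lin_def sum_distrib_left mult.assoc)
    thus ?thesis using sum_cos_lin[OF X, of 0 "\<lambda>j. d * s * l j"] by (simp add: N_def)
  qed
  \<comment> \<open>The kernel is a sum of two squares, so its sum over \<open>S\<close> is at most
    its sum over the cube. The cube average is at most \<open>M + M^2 / (4 * 2^k) = 3 * M\<close>,
    whereas density \<open>2^-k\<close> and half of the peak force at least
    \<open>M^2 / (2 * 2^k) = 4 * M\<close>. This fixes the factor 8 in \<open>M\<close>.\<close>
  have "real (card S) * (real M ^ 2 / 2) = (\<Sum>A\<in>S. real M ^ 2 / 2)" by simp
  also have "\<dots> \<le> (\<Sum>A\<in>S. \<Sum>t<M. \<Sum>t'<M. cos ((real t - real t') * s * lin X l A))"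
  proof (rule sum_mono, rule fejer_ge)
    fix A assume "A \<in> S"
    hence "real M * s * \<bar>lin X l A\<bar> \<le> real M * s * \<beta>" by (intro mult_left_mono small) (use s in auto)
    thus "real M * \<bar>s * lin X l A\<bar> \<le> 1" using Ms s by (simp add: abs_mult mult.assoc)
  qed
  also have "\<dots> \<le> (\<Sum>A\<in>Pow X. \<Sum>t<M. \<Sum>t'<M. cos ((real t - real t') * s * lin X l A))"
  proof (rule sum_mono2)
    fix A
    have "(\<Sum>t<M. \<Sum>t'<M. cos ((real t - real t') * s * lin X l A))
      = (\<Sum>t<M. cos (real t * s * lin X l A))\<^sup>2 + (\<Sum>t<M. sin (real t * s * lin X l A))\<^sup>2"
      by (simp add: power2_eq_square sum_product left_diff_distrib cos_diff sum.distrib)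
    thus "0 \<le> (\<Sum>t<M. \<Sum>t'<M. cos ((real t - real t') * s * lin X l A))" by simp
  qed (use X S in auto)
  also have "\<dots> = (\<Sum>t<M. \<Sum>t'<M. \<Sum>A\<in>Pow X. cos ((real t - real t') * s * lin X l A))"
    by (subst sum.swap, intro sum.cong refl, subst sum.swap, rule refl)
  also have "\<dots> \<le> (\<Sum>t<M. \<Sum>t'<M. N * ((if t = t' then 1 else 0) + 1 / (4 * 2 ^ k)))"
    unfolding mean
  proof (intro sum_mono mult_left_mono)
    fix t t' assume t: "t \<in> {..<M}" "t' \<in> {..<M}"
    show "(\<Prod>j\<in>X. cos ((real t - real t') * s * l j)) \<le> (if t = t' then 1 else 0) + 1 / (4 * 2 ^ k)"
    proof (cases "t = t'")
      case False
      have "(\<Prod>j\<in>X. cos ((real t - real t') * s * l j)) \<le> \<bar>\<Prod>j\<in>X. cos ((real t - real t') * s * l j)\<bar>" by simp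
      also have "\<dots> = (\<Prod>j\<in>X. \<bar>cos ((real t - real t') * s * l j)\<bar>)" by (rule abs_prod)
      also have "\<dots> \<le> 1 / (4 * 2 ^ k)"
        by (rule prod_le) (use False t in auto)
      finally show ?thesis using False by simp
    qed simp
  qed (use N in auto)
  also have "\<dots> = N * (real M + real M ^ 2 * (1 / (4 * 2 ^ k)))"
  proof -
    have "(\<Sum>t<M. \<Sum>t'<M. (if t = t' then 1 else 0) + q) = real M + real M ^ 2 * q" for q :: real
    proof -
      have "(\<Sum>t<M. \<Sum>t'<M. (if t = t' then 1 else 0) + q) = real M * (1 + real M * q)"
        by (simp add: sum.distrib)
      also have "\<dots> = real M + real M ^ 2 * q"
        by (simp only: power2_eq_square distrib_left mult_1_right mult.assoc)
      finally show ?thesis .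
    qed
    thus ?thesis by (simp only: flip: sum_distrib_left)
  qed
  also have "\<dots> = N * (3 * real M)" by (simp add: M_def power2_eq_square)
  finally have "real M * (real M * real (card S)) \<le> real M * (6 * N)" by (simp add: power2_eq_square mult_ac)
  hence "real M * real (card S) \<le> 6 * N" using M by simp
  hence "8 * (2 ^ k * real (card S)) \<le> 6 * N" by (simp add: M_def)
  moreover have "N \<le> 2 ^ k * real (card S)"
    using of_nat_mono[OF dens, where 'a = real] by (simp add: N_def)
  ultimately show False using N by linarith
qed

section \<open>Short functionals agreeing on integer vectors\<close>

lemma sum_fun_apply: "(\<Sum>i\<in>I. f i) x = (\<Sum>i\<in>I. f i x)"
  for f :: "'b \<Rightarrow> 'a \<Rightarrow> 'c::comm_monoid_add"
  by (induction I rule: infinite_finite_induct) auto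

text \<open>Siegel's lemma by the pigeonhole principle; it replaces Cramer's rule and a determinant estimate.\<close>

lemma small_integer_relation:
  fixes v :: "'b \<Rightarrow> 'a \<Rightarrow> int"
  assumes I: "finite I" and B: "finite B" and card: "card I < card B"
    and bound: "\<And>b i. b \<in> B \<Longrightarrow> i \<in> I \<Longrightarrow> \<bar>v b i\<bar> \<le> int D"
    and M: "M + 1 > (2 * card B * D + 1) ^ card I"
  obtains c :: "'b \<Rightarrow> int" where "\<exists>b\<in>B. c b \<noteq> 0" "\<And>b. \<bar>c b\<bar> \<le> int M"
    "\<And>i. i \<in> I \<Longrightarrow> (\<Sum>b\<in>B. c b * v b i) = 0"
proof -
  define F where "F c = (\<lambda>i\<in>I. \<Sum>b\<in>B. int (c b) * v b i)" for c :: "'b \<Rightarrow> nat"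
  define L where "L = int (card B * D * M)"
  have sub: "F ` (B \<rightarrow>\<^sub>E {..M}) \<subseteq> I \<rightarrow>\<^sub>E {-L..L}"
  proof (rule image_subsetI, unfold F_def, rule restrict_PiE_iff[THEN iffD2], rule ballI)
    fix c i assume c: "c \<in> B \<rightarrow>\<^sub>E {..M}" and i: "i \<in> I"
    have "\<bar>\<Sum>b\<in>B. int (c b) * v b i\<bar> \<le> (\<Sum>b\<in>B. int M * int D)"
      by (rule order_trans[OF sum_abs], rule sum_mono, unfold abs_mult, rule mult_mono)
        (use c i bound in \<open>auto simp: PiE_mem\<close>)
    also have "\<dots> = L" by (simp add: L_def)
    finally show "(\<Sum>b\<in>B. int (c b) * v b i) \<in> {-L..L}" by auto
  qed
  \<comment> \<open>With \<open>q = card I\<close>, there are at most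
    \<open>((2 * card B * D + 1) * (M + 1)) ^ q\<close> values but at least
    \<open>(M + 1) ^ (q + 1)\<close> coefficient vectors; the extra factor \<open>M + 1\<close> wins
    by the choice of \<open>M\<close>. Coefficients range over \<open>{..M}\<close> so that
    differences stay within \<open>M\<close>.\<close>
  have "card (I \<rightarrow>\<^sub>E {-L..L}) = (2 * (card B * D * M) + 1) ^ card I"
    using I by (simp add: card_PiE L_def nat_add_distrib nat_mult_distrib mult_ac)
  also have "\<dots> \<le> ((2 * card B * D + 1) * (M + 1)) ^ card I"
    by (rule power_mono) (auto simp: algebra_simps)
  also have "\<dots> = (2 * card B * D + 1) ^ card I * (M + 1) ^ card I"
    by (rule power_mult_distrib)
  also have "\<dots> < (M + 1) * (M + 1) ^ card I"
    by (rule mult_strict_right_mono[OF M]) simp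
  also have "\<dots> = (M + 1) ^ (card I + 1)" by simp
  also have "\<dots> \<le> (M + 1) ^ card B" by (rule power_increasing) (use card in auto)
  also have "\<dots> = card (B \<rightarrow>\<^sub>E {..M})" using B by (simp add: card_PiE)
  finally have lt: "card (I \<rightarrow>\<^sub>E {-L..L}) < card (B \<rightarrow>\<^sub>E {..M})" .
  have "\<not> inj_on F (B \<rightarrow>\<^sub>E {..M})"
  proof
    assume "inj_on F (B \<rightarrow>\<^sub>E {..M})"
    hence "card (B \<rightarrow>\<^sub>E {..M}) \<le> card (I \<rightarrow>\<^sub>E {-L..L})"
      by (rule card_inj_on_le[OF _ sub]) (use I in \<open>auto intro: finite_PiE\<close>)
    with lt show False by simp
  qed
  then obtain c c' where c: "c \<in> B \<rightarrow>\<^sub>E {..M}" "c' \<in> B \<rightarrow>\<^sub>E {..M}" "F c = F c'" "c \<noteq> c'"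
    unfolding inj_on_def by blast
  define e where "e b = (if b \<in> B then int (c b) - int (c' b) else 0)" for b
  show ?thesis
  proof (rule that[of e])
    show "\<exists>b\<in>B. e b \<noteq> 0"
    proof (rule ccontr)
      assume "\<not> ?thesis"
      hence "c b = c' b" if "b \<in> B" for b using that by (auto simp: e_def)
      hence "c = c'" using c by (meson PiE_ext)
      with c show False by simp
    qed
    show "\<bar>e b\<bar> \<le> int M" for b
      using PiE_mem[OF c(1), of b] PiE_mem[OF c(2), of b] by (auto simp: e_def)
    fix i assume "i \<in> I"
    hence "(\<Sum>b\<in>B. int (c b) * v b i) = (\<Sum>b\<in>B. int (c' b) * v b i)"
      using fun_cong[OF c(3), of i] by (simp add: F_def)
    thus "(\<Sum>b\<in>B. e b * v b i) = 0"
      by (simp add: e_def left_diff_distrib sum_subtractf)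
  qed
qed

text \<open>Extend a basis chosen from \<open>Y\<close> by unit vectors and let the new functional vanish on the latter.\<close>

lemma small_functional_agreeing:
  fixes Y :: "('a \<Rightarrow> int) set" and a :: "'a \<Rightarrow> real" and \<delta> :: real
  assumes I: "finite I" and D: "D \<ge> 1"
    and Y: "\<And>y i. y \<in> Y \<Longrightarrow> i \<in> I \<Longrightarrow> \<bar>y i\<bar> \<le> int D"
    and small: "\<And>y. y \<in> Y \<Longrightarrow> \<bar>\<Sum>i\<in>I. a i * y i\<bar> \<le> \<delta>" and \<delta>: "\<delta> \<ge> 0"
  obtains a' :: "'a \<Rightarrow> real"
  where "\<And>y. y \<in> Y \<Longrightarrow> (\<Sum>i\<in>I. a' i * y i) = (\<Sum>i\<in>I. a i * y i)"
    "\<And>i. i \<in> I \<Longrightarrow> \<bar>a' i\<bar> \<le> card I * (2 * (card I + 1) * D + 1) ^ card I * \<delta>"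
proof -
  interpret fvs: vector_space "\<lambda>(c::real) (f :: 'a \<Rightarrow> real) x. c * f x"
    by unfold_locales (auto simp: fun_eq_iff algebra_simps)
  interpret fvp: vector_space_pair "\<lambda>(c::real) (f :: 'a \<Rightarrow> real) x. c * f x" "(*) :: real \<Rightarrow> real \<Rightarrow> real"
    by unfold_locales (auto simp: algebra_simps)
  define r where "r y = (\<lambda>i. if i \<in> I then real_of_int (y i) else 0)" for y :: "'a \<Rightarrow> int"
  define u where "u i = r (\<lambda>j. if j = i then 1 else 0)" for i
  have expand: "f = (\<Sum>i\<in>I. (\<lambda>x. f i * u i x))" if "\<And>i. i \<notin> I \<Longrightarrow> f i = 0" for f :: "'a \<Rightarrow> real"
  proof
    fix x
    have "(\<Sum>i\<in>I. (\<lambda>x. f i * u i x)) x = (\<Sum>i\<in>I. f i * u i x)"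
      by (rule sum_fun_apply)
    also have "\<dots> = (\<Sum>i\<in>I. if i = x then f i else 0)"
      by (rule sum.cong) (auto simp: u_def r_def)
    also have "\<dots> = f x" using I that by simp
    finally show "f x = (\<Sum>i\<in>I. (\<lambda>x. f i * u i x)) x" by simp
  qed
  define V where "V = r ` Y \<union> u ` I"
  have V: "\<exists>y. b = r y \<and> (\<forall>i\<in>I. \<bar>y i\<bar> \<le> int D)" if "b \<in> V" for b
  proof -
    have "b \<in> r ` Y \<or> b \<in> u ` I" using that by (simp add: V_def)
    thus ?thesis
    proof
      assume "b \<in> u ` I"
      then obtain i where "b = u i" by blast
      thus ?thesis using D unfolding u_def by (intro exI[of _ "\<lambda>j. if j = i then 1 else 0"]) auto
    qed (use Y in blast)
  qed
  have inj: "inj_on u I"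
  proof (rule inj_onI)
    fix i j assume ij: "i \<in> I" "j \<in> I" "u i = u j"
    have "u j i = 1" using fun_cong[OF ij(3), of i] ij(1) by (simp add: u_def r_def)
    thus "i = j" using ij(1) by (simp add: u_def r_def split: if_splits)
  qed
  have indep_u: "fvs.independent (u ` I)"
  proof (rule fvs.independent_if_scalars_zero)
    fix f x assume z: "(\<Sum>x\<in>u ` I. (\<lambda>j. f x * x j)) = 0" and x: "x \<in> u ` I"
    obtain i where i: "i \<in> I" "x = u i" using x by blast
    have "0 = (\<Sum>x\<in>u ` I. (\<lambda>j. f x * x j)) i" using z by simp
    also have "\<dots> = (\<Sum>x\<in>u ` I. f x * x i)" by (simp add: sum_fun_apply)
    also have "\<dots> = (\<Sum>j\<in>I. f (u j) * u j i)" by (simp add: sum.reindex[OF inj])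
    also have "\<dots> = (\<Sum>j\<in>I. if j = i then f (u j) else 0)"
      by (rule sum.cong) (use i in \<open>auto simp: u_def r_def\<close>)
    also have "\<dots> = f x" using i I by simp
    finally show "f x = 0" by simp
  qed (use I in simp)
  have card_u: "card (u ` I) = card I" by (rule card_image[OF inj])
  \<comment> \<open>\<open>B0\<close> consists of vectors coming from \<open>Y\<close> itself, so
    that the functional is known to be at most \<open>\<delta>\<close> on each basis vector, not
    merely on their span.\<close>
  obtain B0 where B0: "B0 \<subseteq> r ` Y" "fvs.independent B0" "r ` Y \<subseteq> fvs.span B0"
    using fvs.maximal_independent_subset by metis
  obtain B where B: "B0 \<subseteq> B" "B \<subseteq> V" "fvs.independent B" "V \<subseteq> fvs.span B"
  proof -
    have "B0 \<subseteq> V" using B0(1) by (auto simp: V_def)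
    from fvs.maximal_independent_subset_extend[OF this B0(2)] show ?thesis using that by blast
  qed
  have "r y \<in> fvs.span (u ` I)" for y
    using expand[of "r y"]
    by (auto simp: r_def intro: fvs.span_sum fvs.span_scale fvs.span_base)
  hence "B \<subseteq> fvs.span (u ` I)" using B(2) V by blast
  hence finB: "finite B" and cardB: "card B \<le> card I"
    using fvs.independent_span_bound[of "u ` I" B] B(3) I card_u by auto
  moreover have "card I \<le> card B"
    using fvs.independent_span_bound[of B "u ` I"] finB indep_u B(4) card_u unfolding V_def by auto
  ultimately have cardB: "card B = card I" by simp
  define \<Lambda> where "\<Lambda> f = (\<Sum>i\<in>I. a i * f i)" for f
  have lin\<Lambda>: "Vector_Spaces.linear (\<lambda>(c::real) (f :: 'a \<Rightarrow> real) x. c * f x) (*) \<Lambda>"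
  proof unfold_locales
    fix f f' :: "'a \<Rightarrow> real" and c :: real
    show "\<Lambda> (f + f') = \<Lambda> f + \<Lambda> f'" by (simp add: \<Lambda>_def sum.distrib distrib_left)
    show "\<Lambda> (\<lambda>x. c * f x) = c * \<Lambda> f"
      unfolding \<Lambda>_def sum_distrib_left by (rule sum.cong[OF refl]) (rule mult.left_commute)
  qed
  obtain g where lin: "Vector_Spaces.linear (\<lambda>(c::real) (f :: 'a \<Rightarrow> real) x. c * f x) (*) g"
    and g: "\<And>b. b \<in> B \<Longrightarrow> g b = (if b \<in> B0 then \<Lambda> b else 0)"
    using fvp.linear_independent_extend[OF B(3), of "\<lambda>b. if b \<in> B0 then \<Lambda> b else 0"] by auto
  have g\<Lambda>: "g f = \<Lambda> f" if "f \<in> fvs.span B0" for f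
    by (rule fvp.linear_eq_on[OF lin lin\<Lambda> that]) (use g B(1) in auto)
  have gb: "\<bar>g b\<bar> \<le> \<delta>" if "b \<in> B" for b
  proof (cases "b \<in> B0")
    case True
    then obtain y where "y \<in> Y" "b = r y" using B0(1) by blast
    thus ?thesis using g[OF that] True small[of y] by (simp add: \<Lambda>_def r_def)
  qed (use g[OF that] \<delta> in simp)
  show ?thesis
  proof (rule that[of "\<lambda>i. g (u i)"])
    fix y assume y: "y \<in> Y"
    have "g (r y) = g (\<Sum>i\<in>I. (\<lambda>x. r y i * u i x))"
      by (rule arg_cong[OF expand]) (simp add: r_def)
    also have "\<dots> = (\<Sum>i\<in>I. g (\<lambda>x. r y i * u i x))" by (rule fvp.linear_sum[OF lin])
    also have "\<dots> = (\<Sum>i\<in>I. r y i * g (u i))" by (simp add: fvp.linear_scale[OF lin])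
    finally have "g (r y) = (\<Sum>i\<in>I. g (u i) * y i)" by (simp add: r_def mult.commute)
    moreover have "g (r y) = (\<Sum>i\<in>I. a i * y i)"
      using g\<Lambda>[of "r y"] B0(3) y by (auto simp: \<Lambda>_def r_def)
    ultimately show "(\<Sum>i\<in>I. g (u i) * y i) = (\<Sum>i\<in>I. a i * y i)" by simp
  next
    fix i assume i: "i \<in> I"
    define M where "M = (2 * (card I + 1) * D + 1) ^ card I"
    show "\<bar>g (u i)\<bar> \<le> card I * (2 * (card I + 1) * D + 1) ^ card I * \<delta>"
    proof (cases "u i \<in> B")
      case True
      have "0 < card I" using i I card_gt_0_iff by blast
      hence "1 \<le> card I * M" by (simp add: M_def)
      hence "1 \<le> real (card I * M)" by linarith
      hence "1 * \<delta> \<le> real (card I * M) * \<delta>" by (rule mult_right_mono) (rule \<delta>)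
      thus ?thesis using gb[OF True] by (simp add: M_def)
    next
      case False
      \<comment> \<open>Siegel's lemma is applied to these \<open>card I + 1\<close> integer
        vectors, whose entries are recovered by the floor. By independence of \<open>B\<close> the
        coefficient of \<open>u i\<close> is nonzero, hence at least 1 in absolute value, so solving
        for \<open>g (u i)\<close> costs no division: it is bounded by \<open>card I\<close> terms
        of size \<open>M * \<delta>\<close>.\<close>
      let ?B = "insert (u i) B"
      have repr: "\<exists>y. b = r y \<and> (\<forall>i\<in>I. \<bar>y i\<bar> \<le> int D)" if "b \<in> ?B" for b
        using V that B(2) i by (auto simp: V_def)
      have card: "card ?B = card I + 1" using False finB cardB by simp
      have bnd: "\<bar>\<lfloor>b j\<rfloor>\<bar> \<le> int D" if "b \<in> ?B" "j \<in> I" for b j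
        using repr[OF that(1)] that(2) by (auto simp: r_def)
      have lt: "card I < card ?B" using card by simp
      have M: "(2 * card ?B * D + 1) ^ card I < M + 1" unfolding M_def card by simp
      have finB': "finite ?B" using finB by simp
      obtain c where c: "\<exists>b\<in>?B. c b \<noteq> 0" "\<And>b. \<bar>c b\<bar> \<le> int M"
        "\<And>j. j \<in> I \<Longrightarrow> (\<Sum>b\<in>?B. c b * \<lfloor>b j\<rfloor>) = 0"
        by (rule small_integer_relation[where v = "\<lambda>b j. \<lfloor>b j\<rfloor>" and M = M and D = D, OF I finB' lt])
          (rule bnd, assumption+, rule M, blast)
      have rel: "(\<Sum>b\<in>?B. (\<lambda>x. real_of_int (c b) * b x)) = 0"
      proof
        fix j
        have fl: "real_of_int \<lfloor>b j\<rfloor> = b j" "j \<notin> I \<Longrightarrow> b j = 0" if "b \<in> ?B" for b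
          using repr[OF that] by (auto simp: r_def)
        have "(\<Sum>b\<in>?B. (\<lambda>x. real_of_int (c b) * b x)) j = (\<Sum>b\<in>?B. real_of_int (c b) * b j)"
          by (simp only: sum_fun_apply)
        also have "\<dots> = 0"
        proof (cases "j \<in> I")
          case True
          have "(\<Sum>b\<in>?B. real_of_int (c b) * b j) = (\<Sum>b\<in>?B. real_of_int (c b * \<lfloor>b j\<rfloor>))"
          proof (rule sum.cong[OF refl])
            fix b assume "b \<in> ?B"
            show "real_of_int (c b) * b j = real_of_int (c b * \<lfloor>b j\<rfloor>)"
              by (simp only: of_int_mult fl(1)[OF \<open>b \<in> ?B\<close>])
          qed
          also have "\<dots> = real_of_int (\<Sum>b\<in>?B. c b * \<lfloor>b j\<rfloor>)" by (simp only: of_int_sum)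
          finally show ?thesis using c(3)[OF True] by simp
        next
          case False
          thus ?thesis by (intro sum.neutral) (use fl in auto)
        qed
        finally show "(\<Sum>b\<in>?B. (\<lambda>x. real_of_int (c b) * b x)) j = 0 j" by simp
      qed
      have "c (u i) \<noteq> 0"
      proof
        assume z: "c (u i) = 0"
        hence z': "(\<lambda>x. real_of_int (c (u i)) * u i x) = 0" by (simp add: fun_eq_iff)
        have "(\<Sum>b\<in>B. (\<lambda>x. real_of_int (c b) * b x)) = 0"
          using rel unfolding sum.insert[OF finB False] z' by simp
        hence "real_of_int (c b) = 0" if "b \<in> B" for b
          using fvs.independentD[OF B(3) finB order_refl _ that, of "\<lambda>b. real_of_int (c b)"] by simp
        thus False using c(1) z by auto
      qed
      hence "1 \<le> \<bar>c (u i)\<bar>" by simp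
      hence "1 \<le> \<bar>real_of_int (c (u i))\<bar>" by linarith
      hence "1 * \<bar>g (u i)\<bar> \<le> \<bar>real_of_int (c (u i))\<bar> * \<bar>g (u i)\<bar>"
        by (rule mult_right_mono) simp
      also have "\<dots> = \<bar>real_of_int (c (u i)) * g (u i)\<bar>" by (simp add: abs_mult)
      also have "real_of_int (c (u i)) * g (u i) = - (\<Sum>b\<in>B. real_of_int (c b) * g b)"
      proof -
        have "0 = g (\<Sum>b\<in>?B. (\<lambda>x. real_of_int (c b) * b x))"
          unfolding rel by (rule fvp.linear_0[OF lin, symmetric])
        also have "\<dots> = (\<Sum>b\<in>?B. g (\<lambda>x. real_of_int (c b) * b x))" by (rule fvp.linear_sum[OF lin])
        also have "\<dots> = (\<Sum>b\<in>?B. real_of_int (c b) * g b)" by (simp only: fvp.linear_scale[OF lin])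
        finally show ?thesis using False finB by simp
      qed
      also have "\<bar>- (\<Sum>b\<in>B. real_of_int (c b) * g b)\<bar> \<le> (\<Sum>b\<in>B. real M * \<delta>)"
        unfolding abs_minus_cancel
      proof (rule order_trans[OF sum_abs], rule sum_mono)
        fix b assume b: "b \<in> B"
        have "\<bar>real_of_int (c b)\<bar> \<le> real M" using c(2)[of b] by linarith
        thus "\<bar>real_of_int (c b) * g b\<bar> \<le> real M * \<delta>"
          unfolding abs_mult by (rule mult_mono) (use gb[OF b] in auto)
      qed
      finally show ?thesis by (simp add: cardB M_def)
    qed
  qed
qed

section \<open>A short form agreeing with a concentrated form\<close>

lemma card_le_of_inj_on_Diff:
  assumes X: "finite X" and S: "S \<subseteq> Pow X" and I: "I \<subseteq> X" and inj: "inj_on (\<lambda>A. A - I) S"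
  shows "2 ^ card I * card S \<le> 2 ^ card X"
proof -
  have "card S \<le> card (Pow (X - I))"
    by (rule card_inj_on_le[OF inj]) (use X S in auto)
  also have "\<dots> = 2 ^ (card X - card I)"
    using X I finite_subset[OF I X] by (simp add: card_Pow card_Diff_subset)
  finally have "2 ^ card I * card S \<le> 2 ^ card I * 2 ^ (card X - card I)" by simp
  also have "\<dots> = 2 ^ card X" using card_mono[OF X I] by (simp flip: power_add)
  finally show ?thesis .
qed

lemma maximal_inj_on_Diff:
  assumes X: "finite X"
  obtains I where "I \<subseteq> X" "inj_on (\<lambda>A. A - I) S"
    "\<And>j. j \<in> X - I \<Longrightarrow> \<not> inj_on (\<lambda>A. A - insert j I) S"
proof -
  let ?C = "{I \<in> Pow X. inj_on (\<lambda>A. A - I) S}"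
  have "{} \<in> ?C" by simp
  hence "finite ?C" "?C \<noteq> {}" using X by auto
  from finite_has_maximal[OF this]
  obtain I where I: "I \<in> ?C" "\<forall>J\<in>?C. I \<subseteq> J \<longrightarrow> I = J" by blast
  show ?thesis
  proof (rule that[of I])
    fix j assume j: "j \<in> X - I"
    show "\<not> inj_on (\<lambda>A. A - insert j I) S"
    proof
      assume "inj_on (\<lambda>A. A - insert j I) S"
      hence "insert j I \<in> ?C" using j I(1) by simp
      hence "I = insert j I" using I(2) by (meson subset_insertI)
      thus False using j by blast
    qed
  qed (use I in auto)
qed

text \<open>Failure of injectivity gives two points of \<open>S\<close> that differ only inside
  \<open>insert j I\<close>, and they differ at \<open>j\<close> because deleting \<open>I\<close>
  alone is injective. Subtracting the two values of the form leaves twice the claimed combination,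
  and each value is at most \<open>\<beta>\<close> in absolute value.\<close>

lemma approximate_relation:
  fixes l :: "'a \<Rightarrow> real" and \<beta> :: real
  assumes X: "finite X" and I: "I \<subseteq> X" "j \<in> X - I"
    and small: "\<And>A. A \<in> S \<Longrightarrow> \<bar>lin X l A\<bar> \<le> \<beta>"
    and inj: "inj_on (\<lambda>A. A - I) S" and ninj: "\<not> inj_on (\<lambda>A. A - insert j I) S"
  obtains s :: "'a \<Rightarrow> int" where "\<And>i. \<bar>s i\<bar> \<le> 1" "\<bar>l j - (\<Sum>i\<in>I. s i * l i)\<bar> \<le> \<beta>"
proof -
  obtain A A' where A: "A \<in> S" "A' \<in> S" "A \<noteq> A'" "A - insert j I = A' - insert j I"
    using ninj by (auto simp: inj_on_def)
  have "A - I \<noteq> A' - I" using A inj by (auto simp: inj_on_def)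
  hence "(j \<in> A) \<noteq> (j \<in> A')" using A(4) by blast
  then obtain A A' where A: "A \<in> S" "A' \<in> S" "A - insert j I = A' - insert j I" "j \<in> A" "j \<notin> A'"
    using A by metis
  define s :: "'a \<Rightarrow> int" where "s i = (if i \<in> A' then 1 else 0) - (if i \<in> A then 1 else 0)" for i
  have s: "chi i A - chi i A' = - 2 * real_of_int (s i)" for i by (simp add: s_def chi_def)
  have finI: "finite I" using X I finite_subset by blast
  have "lin X l A - lin X l A' = (\<Sum>i\<in>X. l i * (chi i A - chi i A'))"
    by (simp add: lin_def sum_subtractf right_diff_distrib)
  also have "\<dots> = (\<Sum>i\<in>insert j I. l i * (chi i A - chi i A'))"
  proof (rule sum.mono_neutral_right)
    show "\<forall>i\<in>X - insert j I. l i * (chi i A - chi i A') = 0"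
    proof
      fix i assume "i \<in> X - insert j I"
      hence "i \<in> A \<longleftrightarrow> i \<in> A'" using A(3) by blast
      thus "l i * (chi i A - chi i A') = 0" by (simp add: chi_def)
    qed
  qed (use X I in auto)
  also have "\<dots> = 2 * l j + (\<Sum>i\<in>I. l i * (chi i A - chi i A'))"
    using I finI A(4,5) by (simp add: chi_def)
  also have "(\<Sum>i\<in>I. l i * (chi i A - chi i A')) = - 2 * (\<Sum>i\<in>I. s i * l i)"
    unfolding s sum_distrib_left by (rule sum.cong) (simp_all add: mult_ac)
  finally have "2 * (l j - (\<Sum>i\<in>I. s i * l i)) = lin X l A - lin X l A'" by simp
  hence "\<bar>l j - (\<Sum>i\<in>I. s i * l i)\<bar> \<le> \<beta>"
    using small[OF A(1)] small[OF A(2)] unfolding abs_le_iff by argo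
  thus ?thesis by (intro that[of s]) (auto simp: s_def)
qed

lemma le_two_power: "real k \<le> 2 ^ k"
  using less_exp[of k] by (metis of_nat_le_iff of_nat_numeral of_nat_power less_imp_le)

lemma lin_split:
  assumes "finite X" "Y \<subseteq> X"
  shows "lin X a A = lin Y a A + lin (X - Y) a A"
  unfolding lin_def using sum.subset_diff[OF assms(2,1)] by (simp add: add.commute)

lemma sum_sq_le_card:
  fixes a :: "'a \<Rightarrow> real"
  assumes "\<And>i. i \<in> I \<Longrightarrow> \<bar>a i\<bar> \<le> E"
  shows "(\<Sum>i\<in>I. (a i)\<^sup>2) \<le> real (card I) * E\<^sup>2"
proof -
  have "(\<Sum>i\<in>I. (a i)\<^sup>2) \<le> (\<Sum>i\<in>I. E\<^sup>2)"
    by (rule sum_mono) (use assms in \<open>fastforce simp: abs_le_square_iff[symmetric]\<close>)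
  thus ?thesis by simp
qed

text \<open>The coordinates split into a set \<open>I\<close> whose deletion is injective on \<open>S\<close>, the other large
  coefficients \<open>J\<close>, each approximately a combination of those in \<open>I\<close> with coefficients in
  \<open>{-1, 0, 1}\<close>, and a remainder that is negligible off an exponentially small set.\<close>

lemma small_agreeing_form:
  fixes l :: "'a \<Rightarrow> real" and \<beta> T :: real
  assumes X: "finite X" and S: "S \<subseteq> Pow X" and dens: "2 ^ card X \<le> 2 ^ k * card S"
    and k: "k \<ge> 1" and b: "0 < \<beta>" and T: "T \<ge> 1"
    and small: "\<And>A. A \<in> S \<Longrightarrow> \<bar>lin X l A\<bar> \<le> \<beta>"
  obtains S' and l' :: "'a \<Rightarrow> real" where "S' \<subseteq> S" "card (S - S') \<le> 18 * exp (-T) * 2 ^ card X"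
    "\<And>A. A \<in> S' \<Longrightarrow> lin X l' A = lin X l A"
    "(\<Sum>i\<in>X. (l' i)\<^sup>2) \<le> (2 ^ (18 * k\<^sup>2) * T * \<beta>)\<^sup>2"
proof -
  obtain I where I: "I \<subseteq> X" "inj_on (\<lambda>A. A - I) S"
    and max: "\<And>j. j \<in> X - I \<Longrightarrow> \<not> inj_on (\<lambda>A. A - insert j I) S"
    using maximal_inj_on_Diff[OF X] by metis
  have finI: "finite I" using I(1) X by (rule finite_subset)
  have cardI: "card I \<le> k"
  proof -
    have "2 ^ card I * card S \<le> 2 ^ k * card S"
      using card_le_of_inj_on_Diff[OF X S I] dens by (rule order_trans)
    moreover have "card S \<noteq> 0" using dens by (cases "card S") auto
    ultimately show ?thesis by simp
  qed
  have "\<exists>s::'a \<Rightarrow> int. (\<forall>i. \<bar>s i\<bar> \<le> (1::int)) \<and> \<bar>l j - (\<Sum>i\<in>I. s i * l i)\<bar> \<le> \<beta>" if "j \<in> X - I" for j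
    by (rule approximate_relation[OF X I(1) that small I(2) max[OF that]]) blast+
  then obtain s :: "'a \<Rightarrow> 'a \<Rightarrow> int" where s: "\<And>j i. j \<in> X - I \<Longrightarrow> \<bar>s j i\<bar> \<le> 1"
    and rel: "\<And>j. j \<in> X - I \<Longrightarrow> \<bar>l j - (\<Sum>i\<in>I. s j i * l i)\<bar> \<le> \<beta>"
    by metis
  define \<rho> where "\<rho> j = l j - (\<Sum>i\<in>I. s j i * l i)" for j
  define J where "J = {j\<in>X - I. \<beta> < \<bar>l j\<bar>}"
  define R where "R = X - (I \<union> J)"
  have finJ: "finite J" and finR: "finite R" using X by (auto simp: J_def R_def)
  have JX: "J \<subseteq> X - I" by (auto simp: J_def)
  have cardJ: "card J \<le> 4 ^ k"
  proof -
    have "card J \<le> card {j\<in>X. \<beta> < \<bar>l j\<bar>}" by (rule card_mono) (use X in \<open>auto simp: J_def\<close>)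
    thus ?thesis using card_large_coeffs_le[OF X S dens small] by (rule order_trans)
  qed
  have decomp: "lin X v A = lin I v A + lin J v A + lin R v A" for v A
  proof -
    have "lin X v A = lin (I \<union> J) v A + lin R v A"
      unfolding R_def by (rule lin_split) (use X I JX in auto)
    also have "lin (I \<union> J) v A = lin I v A + lin J v A"
      unfolding lin_def by (rule sum.union_disjoint) (use finI finJ JX in auto)
    finally show ?thesis .
  qed

  \<comment> \<open>\<open>\<sigma>\<^sup>2\<close> is the bound of
    \<open>small_coeffs_norm_le\<close> with \<open>real k + 2\<close> enlarged to
    \<open>4 ^ k\<close>, which uses \<open>k \<ge> 1\<close>.\<close>
  define \<sigma> where "\<sigma> = 2 ^ (4 + 2 * k) * \<beta>"
  have \<sigma>: "\<sigma> > 0" using b by (simp add: \<sigma>_def)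
  have pow4: "(4::real) ^ k = (2 ^ k)\<^sup>2" by (rule four_power)
  have k2: "real k + 2 \<le> 4 ^ k"
    using k by (induction k rule: nat_induct_at_least) auto
  have restnorm: "(\<Sum>j\<in>R. (l j)\<^sup>2) \<le> \<sigma>\<^sup>2"
  proof -
    have "(\<Sum>j\<in>R. (l j)\<^sup>2) \<le> 256 * (real k + 2) * 4 ^ k * \<beta>\<^sup>2"
      by (rule small_coeffs_norm_le[OF X S dens b small]) (auto simp: R_def J_def)
    also have "\<dots> \<le> 256 * 4 ^ k * 4 ^ k * \<beta>\<^sup>2"
      by (intro mult_right_mono mult_left_mono k2) auto
    also have "\<dots> = \<sigma>\<^sup>2"
      unfolding \<sigma>_def power_mult_distrib by (simp add: power_add power_mult power2_eq_square flip: power_mult_distrib)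
    finally show ?thesis .
  qed
  define S' where "S' = {A\<in>S. \<bar>lin R l A\<bar> \<le> T * \<sigma>}"
  \<comment> \<open>On \<open>S'\<close> the part of the form carried by \<open>I\<close> is the
    whole form minus the residuals on \<open>J\<close> and the remainder on \<open>R\<close>. The
    three bounds add up to at most \<open>(1 + 17 * 4^k) * T * \<beta>\<close>, rounded up to
    \<open>32 * 4^k * T * \<beta>\<close>.\<close>
  define \<delta> where "\<delta> = 2 ^ (5 + 2 * k) * T * \<beta>"
  have \<delta>: "\<delta> > 0" using b T by (simp add: \<delta>_def)
  have lost: "card (S - S') \<le> 18 * exp (-T) * 2 ^ card X"
  proof -
    define a where "a j = (if j \<in> R then l j / \<sigma> else 0)" for j
    have "(\<Sum>j\<in>X. (a j)\<^sup>2) = (\<Sum>j\<in>R. (l j)\<^sup>2) / \<sigma>\<^sup>2"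
    proof -
      have "(\<Sum>j\<in>X. (a j)\<^sup>2) = (\<Sum>j\<in>R. (a j)\<^sup>2)"
        by (rule sum.mono_neutral_right) (use X in \<open>auto simp: a_def R_def\<close>)
      thus ?thesis by (simp add: a_def power_divide sum_divide_distrib)
    qed
    hence a: "(\<Sum>j\<in>X. (a j)\<^sup>2) \<le> 1" using restnorm \<sigma> by simp
    have lina: "lin X a A = lin R l A / \<sigma>" for A
    proof -
      have "lin X a A = (\<Sum>j\<in>R. a j * chi j A)" unfolding lin_def
        by (rule sum.mono_neutral_right) (use X in \<open>auto simp: a_def R_def\<close>)
      thus ?thesis by (simp add: a_def lin_def sum_divide_distrib)
    qed
    have "S - S' \<subseteq> {A \<in> Pow X. T < \<bar>lin X a A\<bar>}"
      using S \<sigma> by (auto simp: S'_def lina field_simps)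
    hence "card (S - S') \<le> card {A \<in> Pow X. T < \<bar>lin X a A\<bar>}"
      by (rule card_mono[rotated]) (use X in auto)
    hence "real (card (S - S')) \<le> real (card {A \<in> Pow X. T < \<bar>lin X a A\<bar>})" by (rule of_nat_mono)
    also have "\<dots> \<le> 18 * exp (-T) * 2 ^ card X" by (rule card_lin_tail_le[OF X a T])
    finally show ?thesis .
  qed

  define ic :: "'a \<Rightarrow> 'a set \<Rightarrow> int" where "ic j A = (if j \<in> A then 1 else -1)" for j A
  have ic: "real_of_int (ic j A) = chi j A" for j A by (simp add: ic_def chi_def)
  \<comment> \<open>Inserting the approximate relations for \<open>J\<close> collects the large part
    into a functional of the coefficients on \<open>I\<close>, evaluated at the integer vector
    \<open>y A\<close>. The identity \<open>key\<close> is stated for arbitrary \<open>v\<close> and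
    residuals \<open>r\<close> because it is applied both to \<open>l\<close> and to its
    replacement, with the same residuals.\<close>
  define y where "y A i = ic i A + (\<Sum>j\<in>J. ic j A * s j i)" for A i
  have key: "lin X v A = (\<Sum>i\<in>I. v i * y A i) + (\<Sum>j\<in>J. r j * chi j A) + lin R v A"
    if "\<And>j. j \<in> J \<Longrightarrow> v j = (\<Sum>i\<in>I. s j i * v i) + r j" for v r :: "'a \<Rightarrow> real" and A
  proof -
    have "lin J v A = (\<Sum>j\<in>J. (\<Sum>i\<in>I. v i * (chi j A * s j i)) + r j * chi j A)"
      unfolding lin_def 
    proof (rule sum.cong[OF refl])
      fix j assume "j \<in> J"
      have "(\<Sum>i\<in>I. s j i * v i) * chi j A = (\<Sum>i\<in>I. v i * (chi j A * s j i))"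
        unfolding sum_distrib_right by (rule sum.cong) (simp_all add: mult_ac)
      thus "v j * chi j A = (\<Sum>i\<in>I. v i * (chi j A * s j i)) + r j * chi j A"
        by (simp only: that[OF \<open>j \<in> J\<close>] distrib_right)
    qed
    also have "\<dots> = (\<Sum>i\<in>I. \<Sum>j\<in>J. v i * (chi j A * s j i)) + (\<Sum>j\<in>J. r j * chi j A)"
      by (simp add: sum.distrib sum.swap[of _ I J])
    finally have "lin J v A = (\<Sum>i\<in>I. v i * (\<Sum>j\<in>J. chi j A * s j i)) + (\<Sum>j\<in>J. r j * chi j A)"
      by (simp only: sum_distrib_left)
    moreover have "(\<Sum>i\<in>I. v i * y A i) = lin I v A + (\<Sum>i\<in>I. v i * (\<Sum>j\<in>J. chi j A * s j i))"
      by (simp add: y_def lin_def ic distrib_left sum.distrib)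
    ultimately show ?thesis unfolding decomp by simp
  qed
  have ybound: "\<bar>y A i\<bar> \<le> int (2 * 4 ^ k)" if "i \<in> I" for A i
  proof -
    have "\<bar>y A i\<bar> \<le> \<bar>ic i A\<bar> + \<bar>\<Sum>j\<in>J. ic j A * s j i\<bar>" unfolding y_def by (rule abs_triangle_ineq)
    also have "\<dots> \<le> 1 + (\<Sum>j\<in>J. 1)"
    proof (rule add_mono)
      show "\<bar>\<Sum>j\<in>J. ic j A * s j i\<bar> \<le> (\<Sum>j\<in>J. 1)"
        by (rule order_trans[OF sum_abs], rule sum_mono) (use s JX in \<open>auto simp: abs_mult ic_def\<close>)
    qed (simp add: ic_def)
    also have "\<dots> \<le> 1 + int (4 ^ k)" using of_nat_mono[OF cardJ, where 'a = int] by simp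
    also have "\<dots> \<le> int (2 * 4 ^ k)" by simp
    finally show ?thesis .
  qed
  have rho_sum: "\<bar>\<Sum>j\<in>J. \<rho> j * chi j A\<bar> \<le> 4 ^ k * \<beta>" for A
  proof -
    have "\<bar>\<Sum>j\<in>J. \<rho> j * chi j A\<bar> \<le> (\<Sum>j\<in>J. \<beta>)"
      by (rule order_trans[OF sum_abs], rule sum_mono)
        (use rel JX in \<open>auto simp: abs_mult \<rho>_def\<close>)
    also have "\<dots> = real (card J) * \<beta>" by simp
    also have "\<dots> \<le> 4 ^ k * \<beta>"
      by (rule mult_right_mono) (use cardJ b of_nat_mono[OF cardJ, where 'a = real] in auto)
    finally show ?thesis .
  qed
  have lkey: "lin X l A = (\<Sum>i\<in>I. l i * y A i) + (\<Sum>j\<in>J. \<rho> j * chi j A) + lin R l A" for A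
    by (rule key) (simp add: \<rho>_def)
  have ysmall: "\<bar>\<Sum>i\<in>I. l i * y A i\<bar> \<le> \<delta>" if "A \<in> S'" for A
  proof -
    have "\<bar>\<Sum>i\<in>I. l i * y A i\<bar> \<le> \<beta> + 4 ^ k * \<beta> + T * \<sigma>"
      using lkey[of A] small[of A] rho_sum[of A] that unfolding S'_def by auto
    also have "\<dots> \<le> T * \<beta> + 4 ^ k * (T * \<beta>) + T * \<sigma>"
      by (intro add_mono mult_left_mono order_refl) (use b T in auto)
    also have "\<dots> = (1 + 17 * 4 ^ k) * (T * \<beta>)"
    proof -
      have "(2::real) ^ (4 + 2 * k) = 2 ^ 4 * (2 ^ 2) ^ k" by (simp only: power_add power_mult)
      hence "T * \<sigma> = 16 * 4 ^ k * (T * \<beta>)" by (simp add: \<sigma>_def)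
      thus ?thesis by (simp only: distrib_right mult_1)
    qed
    also have "\<dots> \<le> (32 * 4 ^ k) * (T * \<beta>)"
    proof (rule mult_right_mono)
      have "1 \<le> (4::real) ^ k" by simp
      thus "1 + 17 * 4 ^ k \<le> (32 * 4 ^ k :: real)" by linarith
    qed (use b T in simp)
    also have "\<dots> = \<delta>"
    proof -
      have "(2::real) ^ (5 + 2 * k) = 2 ^ 5 * (2 ^ 2) ^ k" by (simp only: power_add power_mult)
      thus ?thesis by (simp add: \<delta>_def)
    qed
    finally show ?thesis .
  qed
  obtain \<mu> :: "'a \<Rightarrow> real"
    where \<mu>Y: "\<And>z. z \<in> y ` S' \<Longrightarrow> (\<Sum>i\<in>I. \<mu> i * z i) = (\<Sum>i\<in>I. l i * z i)"
      and \<mu>_le: "\<And>i. i \<in> I \<Longrightarrow> \<bar>\<mu> i\<bar> \<le> card I * (2 * (card I + 1) * (2 * 4 ^ k) + 1) ^ card I * \<delta>"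
  proof (rule small_functional_agreeing[of I "2 * 4 ^ k" "y ` S'" l \<delta>])
    show "\<bar>z i\<bar> \<le> int (2 * 4 ^ k)" if "z \<in> y ` S'" "i \<in> I" for z i
      using that ybound by blast
    show "\<bar>\<Sum>i\<in>I. l i * z i\<bar> \<le> \<delta>" if "z \<in> y ` S'" for z
      using that ysmall by blast
  qed (use finI \<delta> in auto)
  have \<mu>: "(\<Sum>i\<in>I. \<mu> i * y A i) = (\<Sum>i\<in>I. l i * y A i)" if "A \<in> S'" for A
    by (rule \<mu>Y) (use that in blast)
  \<comment> \<open>Residuals on \<open>J\<close> and coefficients on \<open>R\<close> are copied
    from \<open>l\<close>, so agreement on \<open>S'\<close> reduces to agreement of
    \<open>\<mu>\<close> with \<open>l\<close> on the vectors \<open>y A\<close>.\<close>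
  define l' where "l' j = (if j \<in> I then \<mu> j else if j \<in> J then (\<Sum>i\<in>I. s j i * \<mu> i) + \<rho> j else l j)" for j
  have l'_I: "l' i = \<mu> i" if "i \<in> I" for i using that by (simp add: l'_def)
  have agree: "lin X l' A = lin X l A" if "A \<in> S'" for A
  proof -
    have "lin X l' A = (\<Sum>i\<in>I. l' i * y A i) + (\<Sum>j\<in>J. \<rho> j * chi j A) + lin R l' A"
      by (rule key) (use JX in \<open>auto simp: l'_def\<close>)
    also have "(\<Sum>i\<in>I. l' i * y A i) = (\<Sum>i\<in>I. l i * y A i)" using \<mu>[OF that] by (simp add: l'_I)
    also have "lin R l' A = lin R l A" by (rule lin_cong) (auto simp: l'_def R_def)
    finally show ?thesis by (simp add: lkey)
  qed

  \<comment> \<open>Exponent count: the Siegel factor is at most \<open>(2^(6k))^k\<close>; the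
    factor \<open>card I\<close> in its bound and the sum of up to \<open>k\<close> values of
    \<open>\<mu>\<close> cost \<open>2^k\<close> each; one doubling absorbs the residual;
    \<open>\<delta>\<close> contributes \<open>5 + 2 * k\<close>.\<close>
  define E where "E = 2 ^ (6 * k\<^sup>2 + 4 * k + 6) * T * \<beta>"
  have E_\<delta>: "E = 2 ^ (6 * k\<^sup>2 + 2 * k + 1) * \<delta>"
  proof -
    have "6 * k\<^sup>2 + 4 * k + 6 = (6 * k\<^sup>2 + 2 * k + 1) + (5 + 2 * k)" by simp
    hence "(2::real) ^ (6 * k\<^sup>2 + 4 * k + 6) = 2 ^ (6 * k\<^sup>2 + 2 * k + 1) * 2 ^ (5 + 2 * k)"
      by (simp only: power_add)
    thus ?thesis by (simp only: E_def \<delta>_def mult.assoc)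
  qed
  define L where "L = 2 ^ k * 2 ^ (6 * k\<^sup>2) * \<delta>"
  have L: "\<bar>\<mu> i\<bar> \<le> L" if "i \<in> I" for i
  proof -
    have "real (2 * (card I + 1) * (2 * 4 ^ k) + 1) \<le> 2 ^ (6 * k)"
    proof -
      have "card I + 1 \<le> 2 ^ k" using cardI less_exp[of k] by linarith
      hence "2 * (card I + 1) * (2 * 4 ^ k) + 1 \<le> 2 * 2 ^ k * (2 * 4 ^ k) + 1"
        by (intro add_right_mono mult_right_mono mult_left_mono) auto
      also have "2 * 2 ^ k * (2 * 4 ^ k) = (2::nat) ^ (3 * k + 2)"
      proof -
        have "(2::nat) ^ (3 * k + 2) = 4 * (2 * 4) ^ k" by (simp add: power_add power_mult)
        thus ?thesis unfolding power_mult_distrib by simp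
      qed
      also have "(2::nat) ^ (3 * k + 2) + 1 \<le> 2 ^ (3 * k + 3)"
      proof -
        have "1 \<le> (2::nat) ^ (3 * k)" by simp
        moreover have "(2::nat) ^ (3 * k + 2) = 4 * 2 ^ (3 * k)" "(2::nat) ^ (3 * k + 3) = 8 * 2 ^ (3 * k)"
          by (simp_all only: power_add) simp_all
        ultimately show ?thesis by linarith
      qed
      also have "\<dots> \<le> 2 ^ (6 * k)" by (rule power_increasing) (use k in auto)
      finally have "real (2 * (card I + 1) * (2 * 4 ^ k) + 1) \<le> real (2 ^ (6 * k))"
        by (rule of_nat_mono)
      also have "\<dots> = 2 ^ (6 * k)" by simp
      finally show ?thesis .
    qed
    hence "real (2 * (card I + 1) * (2 * 4 ^ k) + 1) ^ card I \<le> (2 ^ (6 * k)) ^ card I"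
      by (rule power_mono) simp
    also have "\<dots> \<le> (2 ^ (6 * k)) ^ k" by (rule power_increasing[OF cardI]) simp
    also have "\<dots> = 2 ^ (6 * k\<^sup>2)" by (simp add: power2_eq_square flip: power_mult)
    finally have p: "real (2 * (card I + 1) * (2 * 4 ^ k) + 1) ^ card I \<le> 2 ^ (6 * k\<^sup>2)" .
    have "real (card I) * real (2 * (card I + 1) * (2 * 4 ^ k) + 1) ^ card I * \<delta> \<le> L"
      unfolding L_def
      by (intro mult_right_mono mult_mono p order_trans[OF of_nat_mono[OF cardI] le_two_power]) (use \<delta> in auto)
    thus ?thesis using \<mu>_le[OF that] by simp
  qed
  have \<beta>_\<delta>: "\<beta> \<le> \<delta>"
  proof -
    have "1 * 1 * \<beta> \<le> 2 ^ (5 + 2 * k) * T * \<beta>"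
      by (intro mult_mono one_le_power) (use b T in auto)
    thus ?thesis by (simp add: \<delta>_def)
  qed
  have L': "L = 2 ^ (6 * k\<^sup>2 + k) * \<delta>" by (simp add: L_def power_add)
  have L0: "0 \<le> L" "L \<le> E" "2 ^ k * L + \<beta> \<le> E"
  proof -
    show "0 \<le> L" using \<delta> by (simp add: L_def)
    show "L \<le> E" unfolding L' E_\<delta> by (intro mult_right_mono power_increasing) (use \<delta> in auto)
    have "2 ^ k * L + \<beta> \<le> 2 ^ (6 * k\<^sup>2 + 2 * k) * \<delta> + 2 ^ (6 * k\<^sup>2 + 2 * k) * \<delta>"
    proof (rule add_mono)
      show "2 ^ k * L \<le> 2 ^ (6 * k\<^sup>2 + 2 * k) * \<delta>"
      proof -
        have "6 * k\<^sup>2 + 2 * k = k + (6 * k\<^sup>2 + k)" by simp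
        hence "(2::real) ^ (6 * k\<^sup>2 + 2 * k) = 2 ^ k * 2 ^ (6 * k\<^sup>2 + k)" by (simp only: power_add)
        thus ?thesis by (simp only: L' mult.assoc order_refl)
      qed
      have "1 * \<delta> \<le> 2 ^ (6 * k\<^sup>2 + 2 * k) * \<delta>"
        by (intro mult_right_mono one_le_power) (use \<delta> in auto)
      thus "\<beta> \<le> 2 ^ (6 * k\<^sup>2 + 2 * k) * \<delta>" using \<beta>_\<delta> by linarith
    qed
    also have "\<dots> = E" by (simp add: E_\<delta>)
    finally show "2 ^ k * L + \<beta> \<le> E" .
  qed
  have IJ: "\<bar>l' j\<bar> \<le> E" if "j \<in> I \<union> J" for j
  proof (cases "j \<in> I")
    case True
    thus ?thesis using L[OF True] L0 by (simp add: l'_I)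
  next
    case False
    hence j: "j \<in> J" "j \<in> X - I" using that JX by auto
    have "\<bar>l' j\<bar> \<le> \<bar>\<Sum>i\<in>I. s j i * \<mu> i\<bar> + \<bar>\<rho> j\<bar>" using False j by (simp add: l'_def)
    also have "\<dots> \<le> (\<Sum>i\<in>I. L) + \<beta>"
    proof (rule add_mono)
      show "\<bar>\<Sum>i\<in>I. s j i * \<mu> i\<bar> \<le> (\<Sum>i\<in>I. L)"
      proof (rule order_trans[OF sum_abs], rule sum_mono)
        fix i assume i: "i \<in> I"
        have "\<bar>real_of_int (s j i)\<bar> \<le> 1" using s[OF j(2), of i] by linarith
        thus "\<bar>s j i * \<mu> i\<bar> \<le> L" using L[OF i] mult_mono[of "\<bar>real_of_int (s j i)\<bar>" 1 "\<bar>\<mu> i\<bar>" L]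
          by (simp add: abs_mult)
      qed
      show "\<bar>\<rho> j\<bar> \<le> \<beta>" using rel[OF j(2)] by (simp add: \<rho>_def)
    qed
    also have "\<dots> = real (card I) * L + \<beta>" by simp
    also have "\<dots> \<le> 2 ^ k * L + \<beta>"
      by (intro add_right_mono mult_right_mono order_trans[OF of_nat_mono[OF cardI] le_two_power] L0)
    also have "\<dots> \<le> E" by (rule L0)
    finally show ?thesis .
  qed
  have "(\<Sum>i\<in>X. (l' i)\<^sup>2) = (\<Sum>i\<in>I \<union> J. (l' i)\<^sup>2) + (\<Sum>i\<in>R. (l' i)\<^sup>2)"
  proof -
    have "I \<union> J \<subseteq> X" using I(1) JX by blast
    from sum.subset_diff[OF this X] show ?thesis unfolding R_def by (simp add: add.commute)
  qed
  also have "(\<Sum>i\<in>R. (l' i)\<^sup>2) = (\<Sum>i\<in>R. (l i)\<^sup>2)"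
    by (rule sum.cong) (auto simp: l'_def R_def)
  also have "(\<Sum>i\<in>I \<union> J. (l' i)\<^sup>2) + (\<Sum>i\<in>R. (l i)\<^sup>2) \<le> real (card (I \<union> J)) * E\<^sup>2 + \<sigma>\<^sup>2"
    by (intro add_mono sum_sq_le_card IJ restnorm)
  also have "\<dots> \<le> (2 ^ (2 * k + 1)) * E\<^sup>2 + E\<^sup>2"
  proof (intro add_mono mult_right_mono power_mono)
    have "card (I \<union> J) \<le> k + 4 ^ k" using card_Un_le[of I J] cardI cardJ by linarith
    hence "real (card (I \<union> J)) \<le> real k + 4 ^ k" using of_nat_mono by fastforce
    also have "\<dots> \<le> 4 ^ k + 4 ^ k" using k2 by simp
    also have "\<dots> = 2 ^ (2 * k + 1)" by (simp add: power_mult)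
    finally show "real (card (I \<union> J)) \<le> 2 ^ (2 * k + 1)" .
    have "2 ^ (4 + 2 * k) * 1 * \<beta> \<le> E" unfolding E_def
      by (intro mult_mono power_increasing) (use b T in auto)
    thus "\<sigma> \<le> E" by (simp add: \<sigma>_def)
  qed (use \<sigma> in auto)
  also have "\<dots> \<le> 2 ^ (2 * k + 1) * E\<^sup>2 + 2 ^ (2 * k + 1) * E\<^sup>2"
    using mult_right_mono[of 1 "2 ^ (2 * k + 1)" "E\<^sup>2"] one_le_power[of "2::real" "2 * k + 1"]
    by (intro add_left_mono) simp
  also have "\<dots> = (2 ^ (k + 1) * E)\<^sup>2"
  proof -
    have "(2 ^ (k + 1) * E)\<^sup>2 = 2 ^ ((k + 1) * 2) * E\<^sup>2" by (simp only: power_mult_distrib power_mult)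
    also have "(k + 1) * 2 = Suc (2 * k + 1)" by simp
    finally show ?thesis by simp
  qed
  also have "\<dots> \<le> (2 ^ (18 * k\<^sup>2) * T * \<beta>)\<^sup>2"
  proof (rule power_mono)
    have "2 ^ (k + 1) * E = 2 ^ ((k + 1) + (6 * k\<^sup>2 + 4 * k + 6)) * T * \<beta>"
      by (simp only: E_def power_add mult.assoc)
    also have "\<dots> \<le> 2 ^ (18 * k\<^sup>2) * T * \<beta>"
    proof (intro mult_right_mono power_increasing)
      have "1 \<le> k\<^sup>2" "k \<le> k\<^sup>2" using k by (simp_all add: power2_eq_square)
      thus "(k + 1) + (6 * k\<^sup>2 + 4 * k + 6) \<le> 18 * k\<^sup>2" by linarith
    qed (use b T in auto)
    finally show "2 ^ (k + 1) * E \<le> 2 ^ (18 * k\<^sup>2) * T * \<beta>" .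
  qed (use b T in \<open>auto simp: E_def\<close>)
  finally show ?thesis using that[of S' l'] lost agree by (auto simp: S'_def)
qed

section \<open>The concentration step\<close>

lemma lin_diff: "lin X (\<lambda>i. a i - b i) A = lin X a A - lin X b A"
  by (simp add: lin_def left_diff_distrib sum_subtractf)

lemma lin_scale: "lin X (\<lambda>i. c * a i) A = c * lin X a A"
  by (simp add: lin_def sum_distrib_left mult.assoc)

lemma lin_sum: "lin X (\<lambda>j. \<Sum>i\<in>F. c i * w i j) A = (\<Sum>i\<in>F. c i * lin X (w i) A)"
proof -
  have "lin X (\<lambda>j. \<Sum>i\<in>F. c i * w i j) A = (\<Sum>j\<in>X. \<Sum>i\<in>F. c i * (w i j * chi j A))"
    by (simp add: lin_def sum_distrib_right mult.assoc)
  also have "\<dots> = (\<Sum>i\<in>F. \<Sum>j\<in>X. c i * (w i j * chi j A))" by (rule sum.swap)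
  finally show ?thesis by (simp add: lin_def sum_distrib_left)
qed

text \<open>Pivots of forms vanishing on \<open>S\<close> in reduced echelon form; they stand in for the codimension
  of the span of \<open>S\<close>.\<close>

definition pivots :: "'a set \<Rightarrow> 'a set set \<Rightarrow> 'a set \<Rightarrow> bool" where
  "pivots X S F \<longleftrightarrow> F \<subseteq> X \<and> (\<exists>w :: 'a \<Rightarrow> 'a \<Rightarrow> real. \<forall>i\<in>F.
     (\<forall>j\<in>F. w i j = (if i = j then 1 else 0)) \<and> (\<forall>A\<in>S. lin X (w i) A = 0))"

text \<open>Each row is a unit vector on \<open>F\<close>, so it expresses its pivot sign through
  the signs outside \<open>F\<close>. Deleting \<open>F\<close> is therefore injective on
  \<open>S\<close>.\<close>

lemma card_le_of_pivots:
  assumes X: "finite X" and S: "S \<subseteq> Pow X" and F: "pivots X S F"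
  shows "2 ^ card F * card S \<le> 2 ^ card X"
proof (rule card_le_of_inj_on_Diff[OF X S])
  obtain w :: "'a \<Rightarrow> 'a \<Rightarrow> real" where FX: "F \<subseteq> X"
    and w: "\<And>i j. i \<in> F \<Longrightarrow> j \<in> F \<Longrightarrow> w i j = (if i = j then 1 else 0)"
    and w0: "\<And>i A. i \<in> F \<Longrightarrow> A \<in> S \<Longrightarrow> lin X (w i) A = 0"
    using F unfolding pivots_def by blast
  show "F \<subseteq> X" by (rule FX)
  have finF: "finite F" using FX X by (rule finite_subset)
  have chi: "chi i A = - lin (X - F) (w i) A" if "i \<in> F" "A \<in> S" for i A
  proof -
    have "lin F (w i) A = (\<Sum>j\<in>F. if i = j then chi j A else 0)"
      unfolding lin_def by (rule sum.cong) (use w that in auto)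
    also have "\<dots> = chi i A" using that finF by simp
    finally show ?thesis using w0[OF that] lin_split[OF X FX, of "w i" A] by linarith
  qed
  show "inj_on (\<lambda>A. A - F) S"
  proof (rule inj_onI)
    fix A B assume A: "A \<in> S" and B: "B \<in> S" and eq: "A - F = B - F"
    have "chi j A = chi j B" if "j \<notin> F" for j
    proof -
      have "j \<in> A \<longleftrightarrow> j \<in> B" using that eq by blast
      thus ?thesis by (simp add: chi_def)
    qed
    hence "lin (X - F) v A = lin (X - F) v B" for v by (simp add: lin_def)
    hence "chi i A = chi i B" if "i \<in> F" for i using chi[OF that A] chi[OF that B] by simp
    hence "i \<in> A \<longleftrightarrow> i \<in> B" if "i \<in> F" for i
      using that by (metis chi_def one_neq_neg_one)
    thus "A = B" using eq by blast
  qed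
qed

text \<open>One step of Gauss-Jordan elimination. Clearing the old pivots from \<open>d\<close> does
  not change its values on \<open>S\<close>, where the old rows vanish; the nonzero value at
  \<open>A\<close> thus leaves a nonzero coefficient, which becomes the new pivot and is then
  cleared from the old rows.\<close>

lemma extend_pivots:
  fixes d :: "'a \<Rightarrow> real"
  assumes X: "finite X" and F: "pivots X S F" and S': "S' \<subseteq> S"
    and d: "\<And>A. A \<in> S' \<Longrightarrow> lin X d A = 0" and A: "A \<in> S" "lin X d A \<noteq> 0"
  obtains F' where "pivots X S' F'" "card F' = Suc (card F)"
proof -
  obtain w :: "'a \<Rightarrow> 'a \<Rightarrow> real" where FX: "F \<subseteq> X"
    and w: "\<And>i j. i \<in> F \<Longrightarrow> j \<in> F \<Longrightarrow> w i j = (if i = j then 1 else 0)"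
    and w0: "\<And>i A. i \<in> F \<Longrightarrow> A \<in> S \<Longrightarrow> lin X (w i) A = 0"
    using F unfolding pivots_def by blast
  have finF: "finite F" using FX X by (rule finite_subset)
  define e where "e j = d j - (\<Sum>i\<in>F. d i * w i j)" for j
  have lin_e: "lin X e B = lin X d B" if "B \<in> S" for B
  proof -
    have "lin X e B = lin X d B - (\<Sum>i\<in>F. d i * lin X (w i) B)"
      unfolding e_def lin_diff lin_sum ..
    thus ?thesis using that w0 by simp
  qed
  have eF: "e j = 0" if j: "j \<in> F" for j
  proof -
    have "(\<Sum>i\<in>F. d i * w i j) = (\<Sum>i\<in>F. if i = j then d i else 0)"
      by (rule sum.cong) (use w j in auto)
    thus ?thesis using j finF by (simp add: e_def)
  qed
  have "\<exists>j\<in>X. e j \<noteq> 0"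
  proof (rule ccontr)
    assume "\<not> ?thesis"
    hence "lin X e A = 0" by (simp add: lin_def)
    thus False using lin_e[OF A(1)] A(2) by simp
  qed
  then obtain p where p: "p \<in> X" "e p \<noteq> 0" by blast
  hence pF: "p \<notin> F" using eF by blast
  define u where "u i j = (if i = p then e j / e p else w i j - w i p * (e j / e p))" for i j
  have e': "lin X (\<lambda>j. e j / e p) B = 0" if "B \<in> S'" for B
  proof -
    have "lin X (\<lambda>j. e j / e p) B = lin X (\<lambda>j. (1 / e p) * e j) B" by simp
    also have "\<dots> = (1 / e p) * lin X e B" by (rule lin_scale)
    also have "lin X e B = 0" using lin_e[of B] d[OF that] that S' by auto
    finally show ?thesis by simp
  qed
  have "pivots X S' (insert p F)"
    unfolding pivots_def
  proof (intro conjI exI[of _ u] ballI)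
    show "insert p F \<subseteq> X" using p FX by simp
    fix i assume i: "i \<in> insert p F"
    {
      fix j assume "j \<in> insert p F"
      thus "u i j = (if i = j then 1 else 0)"
        using i p pF by (auto simp: u_def eF w)
    next
      fix B assume B: "B \<in> S'"
      show "lin X (u i) B = 0"
      proof (cases "i = p")
        case True
        hence "u i = (\<lambda>j. e j / e p)" by (auto simp: u_def)
        thus ?thesis using e'[OF B] by simp
      next
        case False
        hence "u i = (\<lambda>j. w i j - w i p * (e j / e p))" by (auto simp: u_def)
        hence "lin X (u i) B = lin X (\<lambda>j. w i j - w i p * (e j / e p)) B" by (simp only:)
        also have "\<dots> = lin X (w i) B - w i p * lin X (\<lambda>j. e j / e p) B"
          by (simp only: lin_diff lin_scale)
        also have "\<dots> = 0" using w0[of i B] B S' e'[OF B] i False by auto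
        finally show ?thesis .
      qed
    }
  qed
  moreover have "card (insert p F) = Suc (card F)" using pF finF by simp
  ultimately show ?thesis using that by blast
qed

text \<open>Only an approximate minimum is needed, so no compactness or projection argument.\<close>

lemma near_minimal_agreeing_form:
  fixes l :: "'a \<Rightarrow> real"
  assumes X: "finite X" and A: "A \<in> S" "lin X l A \<noteq> 0"
  obtains v :: "'a \<Rightarrow> real" where "\<And>A. A \<in> S \<Longrightarrow> lin X v A = lin X l A" "(\<Sum>i\<in>X. (v i)\<^sup>2) > 0"
    "\<And>v' :: 'a \<Rightarrow> real. (\<And>A. A \<in> S \<Longrightarrow> lin X v' A = lin X l A) \<Longrightarrow> (\<Sum>i\<in>X. (v i)\<^sup>2) < 4 * (\<Sum>i\<in>X. (v' i)\<^sup>2)"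
proof -
  define C where "C = {v. \<forall>A\<in>S. lin X v A = lin X l A}"
  define m where "m = Inf ((\<lambda>v. \<Sum>i\<in>X. (v i)\<^sup>2) ` C)"
  have lC: "l \<in> C" by (simp add: C_def)
  \<comment> \<open>Cauchy-Schwarz at the single point \<open>A\<close> bounds the norms in
    \<open>C\<close> away from zero. The infimum \<open>m\<close> is then positive, so
    \<open>m < 4 * m\<close> and some form in \<open>C\<close> lies below
    \<open>4 * m\<close>.\<close>
  have pos: "(lin X l A)\<^sup>2 / (real (card X) + 1) \<le> (\<Sum>i\<in>X. (v i)\<^sup>2)" if "v \<in> C" for v
  proof -
    have "(lin X l A)\<^sup>2 = (lin X v A)\<^sup>2" using that A by (simp add: C_def)
    also have "\<dots> \<le> (\<Sum>i\<in>X. (v i)\<^sup>2) * (\<Sum>i\<in>X. (chi i A)\<^sup>2)"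
      unfolding lin_def by (rule Cauchy_Schwarz_ineq_sum)
    also have "(\<Sum>i\<in>X. (chi i A)\<^sup>2) = real (card X)"
    proof -
      have "(chi i A)\<^sup>2 = 1" for i by (simp add: chi_def)
      thus ?thesis by simp
    qed
    also have "(\<Sum>i\<in>X. (v i)\<^sup>2) * real (card X) \<le> (\<Sum>i\<in>X. (v i)\<^sup>2) * (real (card X) + 1)"
      by (rule mult_left_mono) (auto intro: sum_nonneg)
    finally show ?thesis by (simp add: divide_le_eq)
  qed
  have "0 < (lin X l A)\<^sup>2 / (real (card X) + 1)" using A by (simp add: add_nonneg_pos)
  also have "\<dots> \<le> m" unfolding m_def by (rule cInf_greatest) (use lC pos in auto)
  finally have m: "0 < m" .
  have lower: "m \<le> (\<Sum>i\<in>X. (v i)\<^sup>2)" if "v \<in> C" for v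
    unfolding m_def by (rule cInf_lower) (use that in \<open>auto intro!: bdd_belowI[of _ 0] sum_nonneg\<close>)
  have "\<exists>x\<in>(\<lambda>v. \<Sum>i\<in>X. (v i)\<^sup>2) ` C. x < 4 * m"
    using cInf_lessD[of "(\<lambda>v. \<Sum>i\<in>X. (v i)\<^sup>2) ` C" "4 * m"] lC m unfolding m_def by auto
  then obtain v where v: "v \<in> C" "(\<Sum>i\<in>X. (v i)\<^sup>2) < 4 * m" by auto
  show ?thesis
  proof (rule that[of v])
    show "0 < (\<Sum>i\<in>X. (v i)\<^sup>2)" using m lower[OF v(1)] by linarith
    fix v' :: "'a \<Rightarrow> real" assume "\<And>A. A \<in> S \<Longrightarrow> lin X v' A = lin X l A"
    hence "v' \<in> C" by (simp add: C_def)
    thus "(\<Sum>i\<in>X. (v i)\<^sup>2) < 4 * (\<Sum>i\<in>X. (v' i)\<^sup>2)" using lower v(2) by fastforce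
  qed (use v in \<open>auto simp: C_def\<close>)
qed

text \<open>\<open>h\<close> concentrates where the normalised form is below \<open>\<beta>\<close>; there \<open>small_agreeing_form\<close>
  gives a much shorter agreeing form, and the difference is a new form vanishing on \<open>S'\<close>.\<close>

lemma concentration_step:
  fixes h :: "'a set \<Rightarrow> real" and l :: "'a \<Rightarrow> real" and \<beta> T \<epsilon> \<eta> :: real
  assumes X: "finite X" and k: "k \<ge> 1"
    and h2: "\<And>A. A \<in> Pow X \<Longrightarrow> \<bar>h A\<bar> \<le> 2"
    and sgn: "\<And>A. A \<in> Pow X \<Longrightarrow> 0 \<le> h A * lin X l A"
    and nz: "\<And>A. A \<in> Pow X \<Longrightarrow> h A \<noteq> 0 \<Longrightarrow> lin X l A \<noteq> 0"
    and corr: "\<And>v. (\<Sum>i\<in>X. (v i)\<^sup>2) \<le> 1 \<Longrightarrow> \<bar>\<Sum>A\<in>Pow X. h A * lin X v A\<bar> \<le> \<epsilon> * 2 ^ card X"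
    and mass: "4 * 2 ^ card X \<le> 2 ^ k * (\<Sum>A\<in>Pow X. \<bar>h A\<bar>)"
    and b: "0 < \<beta>" and T: "1 \<le> T" and Tb: "2 ^ (18 * k\<^sup>2) * T * \<beta> \<le> 1 / 2"
    and S: "S \<subseteq> Pow X" and F: "pivots X S F"
    and out: "(\<Sum>A\<in>Pow X - S. \<bar>h A\<bar>) \<le> \<eta> * 2 ^ card X"
    and \<eta>': "\<eta>' = \<eta> + (\<epsilon> + T * \<eta> + 36 * exp (-T)) / \<beta> + 36 * exp (-T)"
    and \<eta>'_le: "\<eta>' * 2 ^ k \<le> 2" and \<eta>0: "0 \<le> \<eta>" and e0: "0 \<le> \<epsilon>"
  obtains S' F' where "S' \<subseteq> Pow X" "pivots X S' F'" "card F' = Suc (card F)"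
    "(\<Sum>A\<in>Pow X - S'. \<bar>h A\<bar>) \<le> \<eta>' * 2 ^ card X"
proof -
  define N :: real where "N = 2 ^ card X"
  define H where "H G = (\<Sum>A\<in>G. \<bar>h A\<bar>)" for G
  define \<kappa> where "\<kappa> = \<epsilon> + T * \<eta> + 36 * exp (-T)"
  have N: "N > 0" by (simp add: N_def)
  have finS: "finite S" using S X by (meson finite_Pow_iff finite_subset)
  have H_split: "H G = H G' + H (G - G')" if "finite G" "G' \<subseteq> G" for G G'
    unfolding H_def using sum.subset_diff[OF that(2,1)] by (simp add: add.commute)
  have H_nonneg: "0 \<le> H G" for G by (simp add: H_def sum_nonneg)
  have \<kappa>0: "0 \<le> \<kappa>" using \<eta>0 e0 T by (simp add: \<kappa>_def)
  have outH: "H (Pow X - S) \<le> \<eta> * N" using out by (simp only: H_def N_def)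
  have massN: "4 * N \<le> 2 ^ k * H (Pow X)" using mass by (simp add: H_def N_def)
  have small_out: "2 ^ k * (\<eta> + \<kappa> / \<beta>) \<le> 2"
  proof -
    have "2 ^ k * (\<eta> + \<kappa> / \<beta>) \<le> 2 ^ k * \<eta>'"
      by (rule mult_left_mono) (simp_all add: \<eta>' \<kappa>_def)
    also have "\<dots> \<le> 2" using \<eta>'_le by (simp only: mult.commute)
    finally show ?thesis .
  qed
  \<comment> \<open>At most half of the guaranteed mass \<open>4 * N / 2^k\<close> has been lost.
    Since \<open>|h| \<le> 2\<close>, the remaining \<open>2 * N / 2^k\<close> forces density at
    least \<open>2^-k\<close>.\<close>
  have large: "2 * N \<le> 2 ^ k * H G" if "G \<subseteq> Pow X" "H (Pow X - G) \<le> (\<eta> + \<kappa> / \<beta>) * N" for G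
  proof -
    have "2 ^ k * H (Pow X - G) \<le> 2 ^ k * ((\<eta> + \<kappa> / \<beta>) * N)"
      by (rule mult_left_mono[OF that(2)]) simp
    also have "\<dots> = (2 ^ k * (\<eta> + \<kappa> / \<beta>)) * N" by simp
    also have "\<dots> \<le> 2 * N" by (rule mult_right_mono[OF small_out]) (use N in simp)
    finally have "2 ^ k * H (Pow X - G) \<le> 2 * N" .
    moreover have "H (Pow X) = H G + H (Pow X - G)" by (rule H_split) (use X that in auto)
    ultimately show ?thesis using massN by (simp add: distrib_left)
  qed
  \<comment> \<open>A point of \<open>S\<close> with \<open>h\<close> nonzero keeps \<open>l\<close>
    from vanishing identically on \<open>S\<close>, as \<open>near_minimal_agreeing_form\<close>
    requires.\<close>
  have "\<exists>A\<in>S. h A \<noteq> 0"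
  proof (rule ccontr)
    assume "\<not> ?thesis"
    hence "H S = 0" by (simp add: H_def)
    moreover have "2 * N \<le> 2 ^ k * H S"
    proof (rule large[OF S])
      have "\<eta> * N \<le> (\<eta> + \<kappa> / \<beta>) * N" by (rule mult_right_mono) (use \<kappa>0 b N in auto)
      with outH show "H (Pow X - S) \<le> (\<eta> + \<kappa> / \<beta>) * N" by (rule order_trans)
    qed
    ultimately show False using N by simp
  qed
  then obtain A0 where A0: "A0 \<in> S" "lin X l A0 \<noteq> 0" using nz S by blast
  obtain v :: "'a \<Rightarrow> real" where v: "\<And>A. A \<in> S \<Longrightarrow> lin X v A = lin X l A"
    and vpos: "(\<Sum>i\<in>X. (v i)\<^sup>2) > 0"
    and vmin: "\<And>v' :: 'a \<Rightarrow> real. (\<And>A. A \<in> S \<Longrightarrow> lin X v' A = lin X l A) \<Longrightarrow> (\<Sum>i\<in>X. (v i)\<^sup>2) < 4 * (\<Sum>i\<in>X. (v' i)\<^sup>2)"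
    using near_minimal_agreeing_form[OF X A0] by blast
  define r where "r = sqrt (\<Sum>i\<in>X. (v i)\<^sup>2)"
  have r: "r > 0" "r\<^sup>2 = (\<Sum>i\<in>X. (v i)\<^sup>2)" using vpos by (auto simp: r_def)
  define a where "a i = (1 / r) * v i" for i
  have lin_a: "lin X a A = (1 / r) * lin X v A" for A unfolding a_def by (rule lin_scale)
  have anorm: "(\<Sum>i\<in>X. (a i)\<^sup>2) \<le> 1"
  proof -
    have "(\<Sum>i\<in>X. (a i)\<^sup>2) = (1 / r)\<^sup>2 * (\<Sum>i\<in>X. (v i)\<^sup>2)"
      by (simp only: a_def power_mult_distrib sum_distrib_left)
    also have "\<dots> = 1" using r by (simp add: power_divide flip: r(2))
    finally show ?thesis by simp
  qed
  have pos: "\<bar>h A\<bar> * \<bar>lin X a A\<bar> = h A * lin X a A" if "A \<in> S" for A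
  proof -
    have "0 \<le> (1 / r) * (h A * lin X l A)" using r sgn[of A] that S by auto
    also have "\<dots> = h A * lin X a A" using v[OF that] by (simp add: lin_a)
    finally have "0 \<le> h A * lin X a A" .
    thus ?thesis by (simp flip: abs_mult)
  qed
  \<comment> \<open>Off \<open>S\<close> the form need not have the sign of \<open>h\<close>, so
    absolute values are taken: where the form is at most \<open>T\<close> the mass bound
    \<open>\<eta>\<close> is used, elsewhere \<open>|h| \<le> 2\<close> and the tail bound.\<close>
  have outside: "(\<Sum>A\<in>Pow X - S. \<bar>h A\<bar> * \<bar>lin X a A\<bar>) \<le> T * \<eta> * N + 36 * exp (-T) * N"
  proof -
    let ?big = "\<lambda>A. if A \<in> Pow X \<and> T < \<bar>lin X a A\<bar> then \<bar>lin X a A\<bar> else 0"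
    have "(\<Sum>A\<in>Pow X - S. \<bar>h A\<bar> * \<bar>lin X a A\<bar>) \<le> (\<Sum>A\<in>Pow X - S. T * \<bar>h A\<bar> + 2 * ?big A)"
    proof (rule sum_mono)
      fix A assume A: "A \<in> Pow X - S"
      show "\<bar>h A\<bar> * \<bar>lin X a A\<bar> \<le> T * \<bar>h A\<bar> + 2 * ?big A"
      proof (cases "T < \<bar>lin X a A\<bar>")
        case True
        have "\<bar>h A\<bar> * \<bar>lin X a A\<bar> \<le> 2 * \<bar>lin X a A\<bar>"
          by (rule mult_right_mono) (use h2 A in auto)
        moreover have "0 \<le> T * \<bar>h A\<bar>" using T by simp
        ultimately show ?thesis using True A by simp
      next
        case False
        hence "\<bar>h A\<bar> * \<bar>lin X a A\<bar> \<le> \<bar>h A\<bar> * T" by (intro mult_left_mono) auto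
        thus ?thesis using False by (simp add: mult.commute)
      qed
    qed
    also have "\<dots> = T * H (Pow X - S) + 2 * (\<Sum>A\<in>Pow X - S. ?big A)"
      by (simp add: sum.distrib sum_distrib_left H_def)
    also have "(\<Sum>A\<in>Pow X - S. ?big A) \<le> (\<Sum>A\<in>Pow X. ?big A)"
      by (rule sum_mono2) (use X in auto)
    also have "(\<Sum>A\<in>Pow X. ?big A) = (\<Sum>A | A \<in> Pow X \<and> T < \<bar>lin X a A\<bar>. \<bar>lin X a A\<bar>)"
      by (rule sum.mono_neutral_cong_right) (use X in auto)
    also have "\<dots> \<le> 18 * exp (-T) * N" unfolding N_def by (rule sum_abs_lin_tail_le[OF X anorm])
    finally have *: "(\<Sum>A\<in>Pow X - S. \<bar>h A\<bar> * \<bar>lin X a A\<bar>) \<le> T * H (Pow X - S) + 2 * (18 * exp (-T) * N)"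
      by simp
    have "T * H (Pow X - S) \<le> T * (\<eta> * N)"
      by (rule mult_left_mono) (use outH T in auto)
    thus ?thesis using * by simp
  qed
  have inside: "(\<Sum>A\<in>S. \<bar>h A\<bar> * \<bar>lin X a A\<bar>) \<le> \<kappa> * N"
  proof -
    have "(\<Sum>A\<in>Pow X. h A * lin X a A) = (\<Sum>A\<in>S. h A * lin X a A) + (\<Sum>A\<in>Pow X - S. h A * lin X a A)"
      using sum.subset_diff[OF S, of "\<lambda>A. h A * lin X a A"] X by simp
    moreover have "(\<Sum>A\<in>S. h A * lin X a A) = (\<Sum>A\<in>S. \<bar>h A\<bar> * \<bar>lin X a A\<bar>)"
      by (rule sum.cong) (simp_all add: pos)
    moreover have "\<bar>\<Sum>A\<in>Pow X - S. h A * lin X a A\<bar> \<le> (\<Sum>A\<in>Pow X - S. \<bar>h A\<bar> * \<bar>lin X a A\<bar>)"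
      by (rule order_trans[OF sum_abs]) (simp add: abs_mult)
    moreover have "\<bar>\<Sum>A\<in>Pow X. h A * lin X a A\<bar> \<le> \<epsilon> * N"
      unfolding N_def by (rule corr[OF anorm])
    ultimately have "(\<Sum>A\<in>S. \<bar>h A\<bar> * \<bar>lin X a A\<bar>) \<le> \<epsilon> * N + (T * \<eta> * N + 36 * exp (-T) * N)"
      using outside by linarith
    also have "\<dots> = \<kappa> * N" by (simp only: \<kappa>_def distrib_right add.assoc)
    finally show ?thesis .
  qed
  define S2 where "S2 = {A\<in>S. \<bar>lin X a A\<bar> \<le> \<beta>}"
  have S2: "S2 \<subseteq> S" "S2 \<subseteq> Pow X" "finite S2" using S finS by (auto simp: S2_def)
  have lost2: "H (S - S2) \<le> \<kappa> / \<beta> * N"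
  proof -
    have "\<beta> * H (S - S2) = (\<Sum>A\<in>S - S2. \<bar>h A\<bar> * \<beta>)"
      by (simp add: H_def sum_distrib_left mult.commute)
    also have "\<dots> \<le> (\<Sum>A\<in>S - S2. \<bar>h A\<bar> * \<bar>lin X a A\<bar>)"
      by (rule sum_mono, rule mult_left_mono) (auto simp: S2_def)
    also have "\<dots> \<le> (\<Sum>A\<in>S. \<bar>h A\<bar> * \<bar>lin X a A\<bar>)"
      by (rule sum_mono2) (use finS in auto)
    also have "\<dots> \<le> \<kappa> * N" by (rule inside)
    finally show ?thesis using b by (simp add: field_simps)
  qed
  have out2: "H (Pow X - S2) \<le> (\<eta> + \<kappa> / \<beta>) * N"
  proof -
    have "H (Pow X - S2) = H (Pow X - S) + H ((Pow X - S2) - (Pow X - S))"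
      by (rule H_split) (use X S2 in auto)
    also have "(Pow X - S2) - (Pow X - S) = S - S2" using S by blast
    finally show ?thesis using outH lost2 unfolding distrib_right by linarith
  qed
  have dens: "2 ^ card X \<le> 2 ^ k * card S2"
  proof -
    have "H S2 \<le> (\<Sum>A\<in>S2. 2)" unfolding H_def by (rule sum_mono) (use h2 S2 in auto)
    hence "H S2 \<le> 2 * real (card S2)" by simp
    hence "2 ^ k * H S2 \<le> 2 ^ k * (2 * real (card S2))" by (rule mult_left_mono) simp
    also have "\<dots> = 2 * (2 ^ k * real (card S2))" by simp
    finally have "N \<le> 2 ^ k * real (card S2)" using large[OF S2(2) out2] by linarith
    hence "real (2 ^ card X) \<le> real (2 ^ k * card S2)" by (simp add: N_def)
    thus ?thesis by (simp only: of_nat_le_iff)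
  qed
  have small: "\<bar>lin X a A\<bar> \<le> \<beta>" if "A \<in> S2" for A using that by (simp add: S2_def)
  obtain S' and a' :: "'a \<Rightarrow> real" where S': "S' \<subseteq> S2"
    and lost3: "card (S2 - S') \<le> 18 * exp (-T) * 2 ^ card X"
    and agree: "\<And>A. A \<in> S' \<Longrightarrow> lin X a' A = lin X a A"
    and short: "(\<Sum>i\<in>X. (a' i)\<^sup>2) \<le> (2 ^ (18 * k\<^sup>2) * T * \<beta>)\<^sup>2"
    using small_agreeing_form[OF X S2(2) dens k b T small] by blast
  define d where "d i = r * a' i - v i" for i
  have lin_d: "lin X d A = r * lin X a' A - lin X v A" for A
    unfolding d_def by (simp only: lin_diff lin_scale)
  have rv: "r * lin X a A = lin X v A" for A using r by (simp add: lin_a)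
  have d0: "lin X d A = 0" if "A \<in> S'" for A
    using lin_d[of A] agree[OF that] rv[of A] by simp
  \<comment> \<open>Otherwise \<open>r * a'\<close> would agree with \<open>l\<close> on all of
    \<open>S\<close> although its norm is at most \<open>r / 2\<close> by \<open>Tb\<close>. The
    factor 4 in near-minimality is the square of this 2.\<close>
  have "\<exists>A\<in>S. lin X d A \<noteq> 0"
  proof (rule ccontr)
    assume "\<not> ?thesis"
    hence "lin X (\<lambda>i. r * a' i) A = lin X l A" if "A \<in> S" for A
      using that v[OF that] lin_d[of A] by (simp add: lin_scale)
    hence "r\<^sup>2 < 4 * (\<Sum>i\<in>X. (r * a' i)\<^sup>2)" using vmin r(2) by simp
    also have "\<dots> = 4 * r\<^sup>2 * (\<Sum>i\<in>X. (a' i)\<^sup>2)"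
      by (simp add: power_mult_distrib sum_distrib_left mult.assoc)
    also have "\<dots> \<le> 4 * r\<^sup>2 * (1 / 2)\<^sup>2"
      by (intro mult_left_mono order_trans[OF short] power_mono Tb) (use b T in auto)
    finally show False by (simp add: power2_eq_square)
  qed
  then obtain A1 where A1: "A1 \<in> S" "lin X d A1 \<noteq> 0" by blast
  have "S' \<subseteq> S" using S' S2 by blast
  then obtain F' where F': "pivots X S' F'" "card F' = Suc (card F)"
    using extend_pivots[OF X F _ d0 A1] by blast
  have "H (Pow X - S') \<le> \<eta>' * N"
  proof -
    have "H (Pow X - S') = H (Pow X - S2) + H ((Pow X - S') - (Pow X - S2))"
      by (rule H_split) (use X S' in auto)
    also have "(Pow X - S') - (Pow X - S2) = S2 - S'" using S2 by blast
    also have "H (S2 - S') \<le> (\<Sum>A\<in>S2 - S'. 2)" unfolding H_def by (rule sum_mono) (use h2 S2 in auto)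
    also have "\<dots> \<le> 36 * exp (-T) * N" using lost3 by (simp add: N_def)
    finally have "H (Pow X - S') \<le> (\<eta> + \<kappa> / \<beta>) * N + 36 * exp (-T) * N" using out2 by linarith
    also have "\<dots> = \<eta>' * N" by (simp only: \<eta>' \<kappa>_def distrib_right)
    finally show ?thesis .
  qed
  thus ?thesis using that[of S' F'] F' \<open>S' \<subseteq> S\<close> S by (auto simp: H_def N_def)
qed

section \<open>From the Chow distance to the distance\<close>

lemma two_power_le_exp: "2 ^ m \<le> exp (real m)"
proof -
  have "2 \<le> exp (1::real)" using exp_ge_add_one_self[of "1::real"] by simp
  hence "2 ^ m \<le> exp (1::real) ^ m" by (rule power_mono) simp
  thus ?thesis by (simp flip: exp_of_nat_mult)
qed

text \<open>If the conclusion fails, both \<open>\<epsilon>\<close> and the tail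
  \<open>exp (-T)\<close> are at most \<open>\<zeta>\<close>, so all errors are multiples of one
  quantity. A round multiplies it by at most \<open>Q \<le> 2^(46 k^2)\<close>, and
  \<open>T = 128 k^3\<close> is large enough for \<open>\<zeta>\<close> to absorb
  \<open>k + 1\<close> such factors and a further \<open>2^k\<close>.\<close>

lemma correlation_lower_bound:
  fixes h :: "'a set \<Rightarrow> real" and l :: "'a \<Rightarrow> real" and \<epsilon> :: real
  assumes X: "finite X" and k: "k \<ge> 1"
    and h2: "\<And>A. A \<in> Pow X \<Longrightarrow> \<bar>h A\<bar> \<le> 2"
    and sgn: "\<And>A. A \<in> Pow X \<Longrightarrow> 0 \<le> h A * lin X l A"
    and nz: "\<And>A. A \<in> Pow X \<Longrightarrow> h A \<noteq> 0 \<Longrightarrow> lin X l A \<noteq> 0"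
    and corr: "\<And>v. (\<Sum>i\<in>X. (v i)\<^sup>2) \<le> 1 \<Longrightarrow> \<bar>\<Sum>A\<in>Pow X. h A * lin X v A\<bar> \<le> \<epsilon> * 2 ^ card X"
    and mass: "4 * 2 ^ card X \<le> 2 ^ k * (\<Sum>A\<in>Pow X. \<bar>h A\<bar>)"
    and e0: "0 \<le> \<epsilon>"
  shows "exp (- (128 * real k ^ 3)) < \<epsilon>"
proof (rule ccontr)
  define T where "T = 128 * real k ^ 3"
  define \<zeta> where "\<zeta> = exp (- T)"
  \<comment> \<open>With \<open>19 * k\<^sup>2\<close> in place of 18, the short form has norm at
    most \<open>2^-(k^2)\<close>, which is at most one half because
    \<open>k \<ge> 1\<close>.\<close>
  define \<beta> where "\<beta> = 1 / (2 ^ (19 * k\<^sup>2) * T)"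
  \<comment> \<open>A round produces at most \<open>1 + 38 + 36 = 75\<close> multiples of
    \<open>T * \<eta> / \<beta>\<close>: the old loss, the loss by thresholding, and the final tail.
    128 is the next power of two.\<close>
  define Q where "Q = 128 * T / \<beta>"
  assume "\<not> ?thesis"
  hence e: "\<epsilon> \<le> \<zeta>" by (simp add: \<zeta>_def T_def)
  have k3: "1 \<le> real k ^ 3" using k by simp
  have T: "1 \<le> T" using k3 by (simp add: T_def)
  have b: "0 < \<beta>" using T by (simp add: \<beta>_def)
  have b1: "\<beta> \<le> 1"
  proof -
    have "1 * 1 \<le> 2 ^ (19 * k\<^sup>2) * T" by (rule mult_mono) (use T in auto)
    thus ?thesis using T by (simp add: \<beta>_def)
  qed
  have Tb: "2 ^ (18 * k\<^sup>2) * T * \<beta> \<le> 1 / 2"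
  proof -
    have "19 * k\<^sup>2 = 18 * k\<^sup>2 + k\<^sup>2" by simp
    hence "(2::real) ^ (19 * k\<^sup>2) = 2 ^ (18 * k\<^sup>2) * 2 ^ (k\<^sup>2)" by (simp only: power_add)
    hence "2 ^ (18 * k\<^sup>2) * T * \<beta> = 1 / 2 ^ (k\<^sup>2)" using T by (simp add: \<beta>_def)
    also have "\<dots> \<le> 1 / 2 ^ 1"
      by (intro divide_left_mono power_increasing) (use k in auto)
    finally show ?thesis by simp
  qed
  have T\<beta>: "T \<le> T / \<beta>" "1 \<le> T / \<beta>"
  proof -
    show "T \<le> T / \<beta>" using b b1 T by (simp add: field_simps)
    thus "1 \<le> T / \<beta>" using T by linarith
  qed
  have Q1: "1 \<le> Q" using T\<beta> by (simp add: Q_def)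
  have \<zeta>: "0 < \<zeta>" by (simp add: \<zeta>_def)
  have Q: "Q \<le> 2 ^ (46 * k\<^sup>2)"
  proof -
    have "real k ^ 3 \<le> (2 ^ k) ^ 3" by (rule power_mono[OF le_two_power]) simp
    hence T': "T \<le> 2 ^ 7 * 2 ^ (k * 3)" by (simp add: T_def power_mult)
    have "Q = 2 ^ 7 * (T * T) * 2 ^ (19 * k\<^sup>2)" using T by (simp add: Q_def \<beta>_def)
    also have "\<dots> \<le> 2 ^ 7 * ((2 ^ 7 * 2 ^ (k * 3)) * (2 ^ 7 * 2 ^ (k * 3))) * 2 ^ (19 * k\<^sup>2)"
      by (intro mult_right_mono mult_left_mono mult_mono T') (use T in auto)
    also have "\<dots> = 2 ^ (7 + ((7 + k * 3) + (7 + k * 3)) + 19 * k\<^sup>2)"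
      by (simp only: power_add)
    also have "\<dots> \<le> 2 ^ (46 * k\<^sup>2)"
    proof (rule power_increasing)
      have "1 \<le> k\<^sup>2" "k \<le> k\<^sup>2" using k by (simp_all add: power2_eq_square)
      thus "7 + ((7 + k * 3) + (7 + k * 3)) + 19 * k\<^sup>2 \<le> 46 * k\<^sup>2" by linarith
    qed simp
    finally show ?thesis .
  qed
  have Qk: "Q ^ (k + 1) * \<zeta> * 2 ^ k \<le> 2"
  proof -
    have "Q ^ (k + 1) \<le> (2 ^ (46 * k\<^sup>2)) ^ (k + 1)" by (rule power_mono[OF Q]) (use Q1 in simp)
    also have "\<dots> = 2 ^ (46 * k\<^sup>2 * (k + 1))" by (simp only: power_mult)
    finally have "Q ^ (k + 1) * 2 ^ k \<le> 2 ^ (46 * k\<^sup>2 * (k + 1)) * 2 ^ k" by (rule mult_right_mono) simp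
    also have "\<dots> = 2 ^ (46 * k\<^sup>2 * (k + 1) + k)" by (simp only: power_add)
    also have "\<dots> \<le> 2 ^ (128 * k ^ 3)"
    proof (rule power_increasing)
      have "k\<^sup>2 \<le> k ^ 3" "k \<le> k ^ 3" using k self_le_power[of k 3] power_increasing[of 2 3 k] by auto
      moreover have "46 * k\<^sup>2 * (k + 1) + k = 46 * k ^ 3 + 46 * k\<^sup>2 + k"
        by (simp add: power2_eq_square power3_eq_cube algebra_simps)
      ultimately show "46 * k\<^sup>2 * (k + 1) + k \<le> 128 * k ^ 3" by linarith
    qed simp
    also have "\<dots> \<le> exp (real (128 * k ^ 3))" by (rule two_power_le_exp)
    also have "\<dots> = exp T" by (simp add: T_def)
    finally have "Q ^ (k + 1) * 2 ^ k * \<zeta> \<le> exp T * \<zeta>" by (rule mult_right_mono) (use \<zeta> in simp)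
    also have "\<dots> = 1" by (simp add: \<zeta>_def flip: exp_add)
    finally show ?thesis by (simp add: mult_ac)
  qed
  \<comment> \<open>The bound starts at \<open>\<zeta>\<close> although nothing is lost for
    \<open>S = Pow X\<close>; this keeps \<open>\<zeta> \<le> \<eta>\<close> in every round, so that
    \<open>\<epsilon>\<close> and the tails can be charged to \<open>\<eta>\<close>.\<close>
  have "\<exists>S F. S \<subseteq> Pow X \<and> pivots X S F \<and> card F = t \<and> (\<Sum>A\<in>Pow X - S. \<bar>h A\<bar>) \<le> Q ^ t * \<zeta> * 2 ^ card X"
    if "t \<le> k + 1" for t
    using that
  proof (induction t)
    case 0
    show ?case using \<zeta> by (intro exI[of _ "Pow X"] exI[of _ "{}"]) (simp add: pivots_def)
  next
    case (Suc t)
    then obtain S F where S: "S \<subseteq> Pow X" "pivots X S F" "card F = t"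
      and out: "(\<Sum>A\<in>Pow X - S. \<bar>h A\<bar>) \<le> Q ^ t * \<zeta> * 2 ^ card X" by auto
    define \<eta> where "\<eta> = Q ^ t * \<zeta>"
    define \<eta>' where "\<eta>' = \<eta> + (\<epsilon> + T * \<eta> + 36 * exp (-T)) / \<beta> + 36 * exp (-T)"
    have \<zeta>\<eta>: "\<zeta> \<le> \<eta>"
      using mult_right_mono[OF one_le_power[OF Q1, of t], of \<zeta>] \<zeta> by (simp add: \<eta>_def)
    hence \<eta>: "0 < \<eta>" using \<zeta> by linarith
    have \<eta>': "\<eta>' \<le> Q ^ Suc t * \<zeta>"
    proof -
      have T\<eta>: "\<eta> \<le> T * \<eta>" using mult_right_mono[OF T, of \<eta>] \<eta> by simp
      have "(\<epsilon> + T * \<eta> + 36 * \<zeta>) / \<beta> \<le> (38 * (T * \<eta>)) / \<beta>"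
        by (rule divide_right_mono) (use e \<zeta>\<eta> T\<eta> b in linarith)+
      moreover have "\<eta> \<le> T * \<eta> / \<beta>" using mult_right_mono[OF T\<beta>(2), of \<eta>] \<eta> by simp
      ultimately have "\<eta>' \<le> 75 * (T * \<eta> / \<beta>)" using \<zeta>\<eta> by (simp add: \<eta>'_def flip: \<zeta>_def)
      also have "\<dots> \<le> 128 * (T * \<eta> / \<beta>)"
        by (rule mult_right_mono) (use \<eta> T b in auto)
      also have "\<dots> = Q ^ Suc t * \<zeta>" by (simp add: Q_def \<eta>_def)
      finally show ?thesis .
    qed
    have "\<eta>' * 2 ^ k \<le> Q ^ Suc t * \<zeta> * 2 ^ k" by (rule mult_right_mono[OF \<eta>']) simp
    also have "\<dots> \<le> Q ^ (k + 1) * \<zeta> * 2 ^ k"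
      by (intro mult_right_mono power_increasing) (use Suc.prems Q1 \<zeta> in auto)
    finally have le2: "\<eta>' * 2 ^ k \<le> 2" using Qk by linarith
    have out': "(\<Sum>A\<in>Pow X - S. \<bar>h A\<bar>) \<le> \<eta> * 2 ^ card X" using out by (simp only: \<eta>_def)
    obtain S' F' where S': "S' \<subseteq> Pow X" "pivots X S' F'" "card F' = Suc (card F)"
      "(\<Sum>A\<in>Pow X - S'. \<bar>h A\<bar>) \<le> \<eta>' * 2 ^ card X"
      using concentration_step[OF X k h2 sgn nz corr mass b T Tb S(1,2) out' \<eta>'_def le2 less_imp_le[OF \<eta>] e0]
      by blast
    have "\<eta>' * 2 ^ card X \<le> Q ^ Suc t * \<zeta> * 2 ^ card X" by (rule mult_right_mono[OF \<eta>']) simp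
    hence "(\<Sum>A\<in>Pow X - S'. \<bar>h A\<bar>) \<le> Q ^ Suc t * \<zeta> * 2 ^ card X" using S'(4) by linarith
    thus ?case using S' S(3) by blast
  qed
  from this[OF order_refl] obtain S F where S: "S \<subseteq> Pow X" "pivots X S F" "card F = k + 1"
    and out: "(\<Sum>A\<in>Pow X - S. \<bar>h A\<bar>) \<le> Q ^ (k + 1) * \<zeta> * 2 ^ card X" by blast
  \<comment> \<open>After scaling by \<open>2^k\<close>, the mass off \<open>S\<close> is at most
    \<open>2 * N\<close>, and \<open>k + 1\<close> relations bound the mass on \<open>S\<close> by
    \<open>N\<close>, against a total of at least \<open>4 * N\<close>. With only \<open>k\<close>
    relations the second bound would be \<open>2 * N\<close> and there would be no
    contradiction.\<close>
  define N :: real where "N = 2 ^ card X"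
  have N: "N > 0" by (simp add: N_def)
  have "2 ^ (k + 1) * card S \<le> 2 ^ card X" using card_le_of_pivots[OF X S(1,2)] S(3) by simp
  from of_nat_mono[OF this, where 'a = real] have c: "2 * (2 ^ k * real (card S)) \<le> N" by (simp add: N_def)
  have "2 ^ k * (\<Sum>A\<in>Pow X - S. \<bar>h A\<bar>) \<le> 2 ^ k * (Q ^ (k + 1) * \<zeta> * N)"
    unfolding N_def by (rule mult_left_mono[OF out]) simp
  also have "\<dots> = (Q ^ (k + 1) * \<zeta> * 2 ^ k) * N" by (simp only: mult_ac)
  also have "\<dots> \<le> 2 * N" by (rule mult_right_mono[OF Qk]) (use N in simp)
  finally have o: "2 ^ k * (\<Sum>A\<in>Pow X - S. \<bar>h A\<bar>) \<le> 2 * N" .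
  have "(\<Sum>A\<in>S. \<bar>h A\<bar>) \<le> (\<Sum>A\<in>S. 2)" by (rule sum_mono) (use h2 S in auto)
  hence "2 ^ k * (\<Sum>A\<in>S. \<bar>h A\<bar>) \<le> 2 ^ k * (2 * real (card S))" by (intro mult_left_mono) simp_all
  also have "\<dots> = 2 * (2 ^ k * real (card S))" by simp
  finally have i: "2 ^ k * (\<Sum>A\<in>S. \<bar>h A\<bar>) \<le> N" using c by linarith
  have "(\<Sum>A\<in>Pow X. \<bar>h A\<bar>) = (\<Sum>A\<in>Pow X - S. \<bar>h A\<bar>) + (\<Sum>A\<in>S. \<bar>h A\<bar>)"
    by (rule sum.subset_diff[OF S(1)]) (use X in simp)
  hence "2 ^ k * (\<Sum>A\<in>Pow X. \<bar>h A\<bar>) \<le> 3 * N" using o i by (simp only: distrib_left)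
  thus False using mass N unfolding N_def by linarith
qed

text \<open>Index \<open>0\<close> carries the constant term of an affine form: only sets \<open>A\<close> with \<open>0 \<in> A\<close>, half of the
  enlarged cube, represent points of \<open>cube n\<close>.\<close>

definition point :: "nat \<Rightarrow> nat set \<Rightarrow> real list" where
  "point n A = map (\<lambda>i. chi (Suc i) A) [0..<n]"

lemma nth_point [simp]: "i < n \<Longrightarrow> point n A ! i = chi (Suc i) A"
  by (simp add: point_def)

lemma point_in_cube: "point n A \<in> cube n"
  by (auto simp: cube_def point_def chi_def)

lemma finite_cube: "finite (cube n)"
proof -
  have "cube n = {x. set x \<subseteq> {-1, 1} \<and> length x = n}" by (auto simp: cube_def)
  thus ?thesis by (simp add: finite_lists_length_eq)
qed

lemma sum_cube:
  fixes G :: "real list \<Rightarrow> real"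
  shows "(\<Sum>x\<in>cube n. G x) = (\<Sum>A\<in>Pow {..n}. if 0 \<in> A then G (point n A) else 0)"
proof -
  have "(\<Sum>x\<in>cube n. G x) = (\<Sum>A\<in>{A\<in>Pow {..n}. 0 \<in> A}. G (point n A))"
  proof (rule sum.reindex_bij_witness[of _ "point n" "\<lambda>x. insert 0 (Suc ` {i. i < n \<and> x ! i = 1})"])
    fix x assume x: "x \<in> cube n"
    hence len: "length x = n" and pm: "\<And>i. i < n \<Longrightarrow> x ! i = 1 \<or> x ! i = -1"
      by (auto simp: cube_def dest: nth_mem)
    show "point n (insert 0 (Suc ` {i. i < n \<and> x ! i = 1})) = x"
      by (rule nth_equalityI) (use len pm in \<open>force simp: point_def chi_def image_iff\<close>)+
    show "insert 0 (Suc ` {i. i < n \<and> x ! i = 1}) \<in> {A \<in> Pow {..n}. 0 \<in> A}" by auto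
    thus "G (point n (insert 0 (Suc ` {i. i < n \<and> x ! i = 1}))) = G x"
      using \<open>point n (insert 0 (Suc ` {i. i < n \<and> x ! i = 1})) = x\<close> by simp
  next
    fix A assume A: "A \<in> {A \<in> Pow {..n}. 0 \<in> A}"
    show "point n A \<in> cube n" by (rule point_in_cube)
    show "insert 0 (Suc ` {i. i < n \<and> point n A ! i = 1}) = A"
    proof (rule set_eqI)
      fix j show "j \<in> insert 0 (Suc ` {i. i < n \<and> point n A ! i = 1}) \<longleftrightarrow> j \<in> A"
        using A by (cases j) (auto simp: chi_def image_iff split: if_splits)
    qed
  qed
  also have "\<dots> = (\<Sum>A\<in>Pow {..n}. if 0 \<in> A then G (point n A) else 0)"
    by (rule sum.inter_filter) simp
  finally show ?thesis .
qed

lemma lin_point: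
  assumes "0 \<in> A"
  shows "lin {..n} v A = v 0 + (\<Sum>i<n. v (Suc i) * point n A ! i)"
  using assms by (simp add: lin_def sum.atMost_shift chi_def[of 0])

text \<open>The correlation of \<open>f - g\<close> with an affine form is the inner product of the
  coefficient vector with the difference of the Chow vectors, so Cauchy-Schwarz applies.\<close>

lemma chow_correlation:
  assumes "d_chow n f g \<le> \<epsilon>" and v: "(\<Sum>i\<le>n. (v i)\<^sup>2) \<le> (1::real)"
  shows "\<bar>\<Sum>x\<in>cube n. (f x - g x) * (v 0 + (\<Sum>i<n. v (Suc i) * x ! i))\<bar> \<le> \<epsilon> * 2 ^ n"
proof -
  define D where "D i = chow n f i - chow n g i" for i
  have D0: "2 ^ n * D 0 = (\<Sum>x\<in>cube n. f x - g x)"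
    by (simp add: D_def chow_def expect_def sum_subtractf field_simps)
  have DS: "2 ^ n * D (Suc i) = (\<Sum>x\<in>cube n. (f x - g x) * x ! i)" for i
    by (simp add: D_def chow_def expect_def sum_subtractf field_simps)
  have "(\<Sum>x\<in>cube n. (f x - g x) * (v 0 + (\<Sum>i<n. v (Suc i) * x ! i)))
      = (\<Sum>x\<in>cube n. v 0 * (f x - g x)) + (\<Sum>x\<in>cube n. \<Sum>i<n. v (Suc i) * ((f x - g x) * x ! i))"
    unfolding distrib_left sum.distrib sum_distrib_left by (simp only: mult_ac)
  also have "(\<Sum>x\<in>cube n. \<Sum>i<n. v (Suc i) * ((f x - g x) * x ! i)) = (\<Sum>i<n. v (Suc i) * (2 ^ n * D (Suc i)))"
    unfolding DS sum_distrib_left by (rule sum.swap)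
  also have "(\<Sum>x\<in>cube n. v 0 * (f x - g x)) = v 0 * (2 ^ n * D 0)"
    unfolding D0 sum_distrib_left ..
  also have "v 0 * (2 ^ n * D 0) + (\<Sum>i<n. v (Suc i) * (2 ^ n * D (Suc i))) = 2 ^ n * (\<Sum>i\<le>n. v i * D i)"
    unfolding sum.atMost_shift distrib_left sum_distrib_left by (simp only: mult_ac)
  finally have eq: "(\<Sum>x\<in>cube n. (f x - g x) * (v 0 + (\<Sum>i<n. v (Suc i) * x ! i))) = 2 ^ n * (\<Sum>i\<le>n. v i * D i)" .
  have "(\<Sum>i\<le>n. v i * D i)\<^sup>2 \<le> (\<Sum>i\<le>n. (v i)\<^sup>2) * (\<Sum>i\<le>n. (D i)\<^sup>2)"
    by (rule Cauchy_Schwarz_ineq_sum)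
  also have "\<dots> \<le> 1 * (\<Sum>i\<le>n. (D i)\<^sup>2)" by (rule mult_right_mono[OF v]) (simp add: sum_nonneg)
  finally have "\<bar>\<Sum>i\<le>n. v i * D i\<bar> \<le> d_chow n f g"
    unfolding d_chow_def D_def[symmetric] by (intro real_le_rsqrt) simp
  hence "\<bar>\<Sum>i\<le>n. v i * D i\<bar> \<le> \<epsilon>" using assms(1) by linarith
  thus ?thesis unfolding eq by (simp add: abs_mult mult.commute)
qed

text \<open>Since \<open>sign 0 = 1\<close>, a defining form may vanish on the cube. Its finitely
  many negative values are at most \<open>- m\<close> for some \<open>m > 0\<close>, so lowering the
  threshold by \<open>m / 2\<close> makes the zeros positive and changes no sign. The
  \<open>insert 1\<close> covers the case without negative values.\<close>

lemma is_LTF_strict: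
  assumes "is_LTF n f"
  obtains w :: "nat \<Rightarrow> real" and \<theta> :: real
  where "\<And>x. x \<in> cube n \<Longrightarrow> (\<Sum>i<n. w i * x ! i) - \<theta> \<noteq> 0"
    "\<And>x. x \<in> cube n \<Longrightarrow> f x = sign ((\<Sum>i<n. w i * x ! i) - \<theta>)"
proof -
  obtain w \<theta> where f: "\<And>x. x \<in> cube n \<Longrightarrow> f x = sign ((\<Sum>i<n. w i * x ! i) - \<theta>)"
    using assms unfolding is_LTF_def by blast
  define z where "z x = (\<Sum>i<n. w i * x ! i) - \<theta>" for x :: "real list"
  define m where "m = Min (insert 1 ((\<lambda>x. - z x) ` {x\<in>cube n. z x < 0}))"
  have fin: "finite (insert 1 ((\<lambda>x. - z x) ` {x\<in>cube n. z x < 0}))" using finite_cube by simp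
  have m: "0 < m" unfolding m_def using fin by (subst Min_gr_iff) auto
  have neg: "z x \<le> - m" if "x \<in> cube n" "z x < 0" for x
  proof -
    have "m \<le> - z x" unfolding m_def by (rule Min_le[OF fin]) (use that in auto)
    thus ?thesis by simp
  qed
  have eq: "(\<Sum>i<n. w i * x ! i) - (\<theta> - m / 2) = z x + m / 2" for x by (simp add: z_def)
  show ?thesis
  proof (rule that[of w "\<theta> - m / 2"])
    fix x assume x: "x \<in> cube n"
    show "(\<Sum>i<n. w i * x ! i) - (\<theta> - m / 2) \<noteq> 0"
      unfolding eq using neg[OF x] m by (cases "z x < 0") auto
    show "f x = sign ((\<Sum>i<n. w i * x ! i) - (\<theta> - m / 2))"
      unfolding eq f[OF x] z_def[symmetric] using neg[OF x] m by (cases "z x < 0") (auto simp: sign_def)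
  qed
qed

text \<open>The constant is \<open>8 = 4 * 2\<close>: the enlarged cube has
  \<open>2 ^ (n + 1)\<close> points, while \<open>h\<close> is supported on the half that represents
  \<open>cube n\<close>.\<close>

lemma chow_distance_lower_bound:
  assumes f: "is_LTF n f" and g: "\<And>x. x \<in> cube n \<Longrightarrow> -1 \<le> g x \<and> g x \<le> 1"
    and d: "d_chow n f g \<le> \<epsilon>" and k: "k \<ge> 1" and far: "8 \<le> 2 ^ k * dist_fn n f g"
  shows "exp (- (128 * real k ^ 3)) < \<epsilon>"
proof -
  obtain w :: "nat \<Rightarrow> real" and \<theta> :: real
    where nz: "\<And>x. x \<in> cube n \<Longrightarrow> (\<Sum>i<n. w i * x ! i) - \<theta> \<noteq> 0"
      and fs: "\<And>x. x \<in> cube n \<Longrightarrow> f x = sign ((\<Sum>i<n. w i * x ! i) - \<theta>)"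
    using is_LTF_strict[OF f] by blast
  define h where "h A = (if 0 \<in> A then f (point n A) - g (point n A) else 0)" for A
  define l where "l i = (case i of 0 \<Rightarrow> - \<theta> | Suc j \<Rightarrow> w j)" for i
  have l: "lin {..n} l A = (\<Sum>i<n. w i * point n A ! i) - \<theta>" if "0 \<in> A" for A
    by (simp add: lin_point[OF that] l_def)
  have e0: "0 \<le> \<epsilon>" by (rule order_trans[OF _ d]) (simp add: d_chow_def sum_nonneg)
  show ?thesis
  proof (rule correlation_lower_bound[of "{..n}" k h l \<epsilon>])
    fix A :: "nat set"
    let ?x = "point n A"
    have x: "?x \<in> cube n" by (rule point_in_cube)
    show "\<bar>h A\<bar> \<le> 2" using g[OF x] fs[OF x] by (auto simp: h_def sign_def)
    show "0 \<le> h A * lin {..n} l A"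
      using g[OF x] fs[OF x] by (auto simp: h_def l sign_def mult_nonneg_nonneg mult_nonpos_nonpos)
    show "lin {..n} l A \<noteq> 0" if "h A \<noteq> 0"
      using that nz[OF x] by (auto simp: h_def l split: if_splits)
  next
    fix v :: "nat \<Rightarrow> real" assume v: "(\<Sum>i\<le>n. (v i)\<^sup>2) \<le> 1"
    have "(\<Sum>A\<in>Pow {..n}. h A * lin {..n} v A)
        = (\<Sum>x\<in>cube n. (f x - g x) * (v 0 + (\<Sum>i<n. v (Suc i) * x ! i)))"
      unfolding sum_cube by (rule sum.cong) (auto simp: h_def lin_point)
    hence "\<bar>\<Sum>A\<in>Pow {..n}. h A * lin {..n} v A\<bar> \<le> \<epsilon> * 2 ^ n"
      using chow_correlation[OF d v] by simp
    also have "\<dots> \<le> \<epsilon> * 2 ^ card {..n}" by (rule mult_left_mono) (use e0 in auto)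
    finally show "\<bar>\<Sum>A\<in>Pow {..n}. h A * lin {..n} v A\<bar> \<le> \<epsilon> * 2 ^ card {..n}" .
  next
    have "(\<Sum>A\<in>Pow {..n}. \<bar>h A\<bar>) = (\<Sum>x\<in>cube n. \<bar>f x - g x\<bar>)"
      unfolding sum_cube by (rule sum.cong) (auto simp: h_def)
    also have "\<dots> = 2 ^ n * dist_fn n f g" by (simp add: dist_fn_def expect_def)
    finally have "2 ^ k * (\<Sum>A\<in>Pow {..n}. \<bar>h A\<bar>) = 2 ^ n * (2 ^ k * dist_fn n f g)" by simp
    moreover have "2 ^ n * 8 \<le> 2 ^ n * (2 ^ k * dist_fn n f g)" by (rule mult_left_mono[OF far]) simp
    ultimately show "4 * 2 ^ card {..n} \<le> 2 ^ k * (\<Sum>A\<in>Pow {..n}. \<bar>h A\<bar>)" by simp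
  qed (use k e0 in auto)
qed

theorem theorem7:
  "\<exists>c>0. \<exists>\<epsilon>0>0. \<forall>(n::nat) (f::real list \<Rightarrow> real) (g::real list \<Rightarrow> real) (\<epsilon>::real).
     is_LTF n f \<and> (\<forall>x\<in>cube n. -1 \<le> g x \<and> g x \<le> 1) \<and>
     0 < \<epsilon> \<and> \<epsilon> < \<epsilon>0 \<and> d_chow n f g \<le> \<epsilon>
     \<longrightarrow> dist_fn n f g \<le> 2 powr (- c * root 3 (ln (1 / \<epsilon>)))"
proof (rule exI[of _ "1 / 16"], intro conjI exI[of _ "exp (- (64 ^ 3))"] allI impI)
  fix n :: nat and f g :: "real list \<Rightarrow> real" and \<epsilon> :: real
  assume asm: "is_LTF n f \<and> (\<forall>x\<in>cube n. -1 \<le> g x \<and> g x \<le> 1) \<and>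
     0 < \<epsilon> \<and> \<epsilon> < exp (- (64 ^ 3)) \<and> d_chow n f g \<le> \<epsilon>"
  define L where "L = ln (1 / \<epsilon>)"
  define r where "r = root 3 L"
  have "ln \<epsilon> < - (64 ^ 3)" using asm by (metis exp_gt_zero ln_exp ln_less_cancel_iff)
  hence L: "64 ^ 3 < L" using asm by (simp add: L_def ln_div)
  have r3: "r ^ 3 = L" using L by (simp add: r_def)
  have "root 3 (64 ^ 3) < r" unfolding r_def using L by (simp only: real_root_less_iff zero_less_numeral)
  hence r: "64 < r" by (simp add: real_root_power_cancel)
  show "dist_fn n f g \<le> 2 powr (- (1 / 16) * root 3 (ln (1 / \<epsilon>)))"
  proof (rule ccontr)
    assume "\<not> ?thesis"
    hence far: "2 powr (- (r / 16)) < dist_fn n f g" by (simp add: r_def L_def)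
    \<comment> \<open>The summand 3 supplies the factor 8 required by
      \<open>chow_distance_lower_bound\<close>. For \<open>r > 64\<close> one has
      \<open>k \<le> r / 16 + 4 \<le> r / 8\<close>, so \<open>128 * k ^ 3 \<le> L / 4\<close>; this
      is the origin of \<open>1 / 16\<close> and of the threshold
      \<open>exp (- (64 ^ 3))\<close>.\<close>
    define k where "k = nat \<lceil>r / 16\<rceil> + 3"
    have k: "real k \<le> r / 16 + 4" "r / 16 \<le> real k - 3" using r unfolding k_def by linarith+
    have "8 * 1 = 8 * (2 powr (r / 16) * 2 powr (- (r / 16)))" by (simp flip: powr_add)
    also have "\<dots> \<le> 8 * (2 powr (real k - 3) * 2 powr (- (r / 16)))"
      by (intro mult_left_mono mult_right_mono powr_mono k) auto
    also have "\<dots> = 2 ^ k * 2 powr (- (r / 16))"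
      by (simp add: powr_diff powr_realpow)
    also have "\<dots> \<le> 2 ^ k * dist_fn n f g" by (rule mult_left_mono) (use far in auto)
    finally have "8 \<le> 2 ^ k * dist_fn n f g" by simp
    hence "exp (- (128 * real k ^ 3)) < \<epsilon>"
      by (intro chow_distance_lower_bound[of n f g]) (use asm in \<open>auto simp: k_def\<close>)
    hence "- (128 * real k ^ 3) < ln \<epsilon>" using asm by (metis exp_gt_zero ln_exp ln_less_cancel_iff)
    hence "L < 128 * real k ^ 3" using asm by (simp add: L_def ln_div)
    also have "\<dots> \<le> 128 * (r / 8) ^ 3"
      by (intro mult_left_mono power_mono) (use k r in auto)
    also have "\<dots> = L / 4" using r3 by (simp add: power_divide)
    finally show False using L by simp
  qed
qed auto

end
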